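(* Let $1\le k<n-2$ and $1\le r<n-k$. For any origin-symmetric star body $K$ in $\mathbb{R}^n$ we have $$\mathrm{as}_r(K)\le \phi_{n,k,r}^k\, d_{\rm ovr}^k(K,\mathcal{BP}_k^n)\, |K|^{\frac{k}{n}}\, \max_{E\in \mathrm{Gr}_{n-k}} \mathrm{as}_r(K\cap E),$$ where $$\phi_{n,k,r}^k=\frac{\omega_{n-r}}{\omega_{n-k-r}\,\omega_n^{\frac{k}{n}}}.$$
   Context: $|\cdot|$ denotes volume in the appropriate dimension, $\omega_m$ is the volume of the Euclidean unit ball in $\mathbb{R}^m$, and $\mathrm{Gr}_{m}$ is the Grassmannian of $m$-dimensional linear subspaces of $\mathbb{R}^n$, with Haar probability measure $\nu_m$. A compact set $K\subset\mathbb{R}^n$ is star-shaped at $0$ if it contains the origin in its interior and every line through $0$ meets $K$ in a line segment; its radial function is $\rho_K(\theta)=\max\{\lambda>0:\lambda\theta\in K\}$, $\theta\in S^{n-1}$. If $\rho_K$ is continuous, $K$ is called a star body. Origin-symmetric means $K=-K$. For $1\le r\le n-1$, $\mathrm{as}_r(K)=\int_{\mathrm{Gr}_{n-r}}|K\cap F|\,d\nu_{n-r}(F)$ is the average volume of $r$-codimensional central sections of $K$. For $E\in\mathrm{Gr}_{n-k}$, $\mathrm{as}_r(K\cap E)$ is the same functional computed inside $E\cong\mathbb{R}^{n-k}$: the average of $|K\cap F|$ over all $(n-k-r)$-dimensional subspaces $F$ of $E$ with respect to the Haar probability measure on the Grassmannian of such subspaces. For $1\le k\le n-1$, the spherical Radon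 transform $R_{n-k}:C(S^{n-1})\to C(\mathrm{Gr}_{n-k})$ is $R_{n-k}g(E)=\int_{S^{n-1}\cap E} g(\theta)\,d\theta$, with $d\theta$ the non-normalized surface measure. An origin-symmetric star body $D$ in $\mathbb{R}^n$ is a generalized $k$-intersection body, written $D\in\mathcal{BP}_k^n$, if there is a finite non-negative Borel measure $\mu_D$ on $\mathrm{Gr}_{n-k}$ such that for every $g\in C(S^{n-1})$, $\int_{S^{n-1}}\rho_D^k(\theta) g(\theta)\,d\theta=\int_{\mathrm{Gr}_{n-k}} R_{n-k}g(H)\,d\mu_D(H)$. The outer volume ratio distance is $d_{\rm ovr}(K,\mathcal{BP}_k^n)=\inf\{(|D|/|K|)^{1/n}: K\subset D,\ D\in\mathcal{BP}_k^n\}$, and $d_{\rm ovr}^k$ denotes its $k$-th power. *)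

theory Defs
  imports "HOL-Analysis.Analysis" "HOL-Probability.Probability"
begin

section \<open>Volume in a subspace and surface measure on its unit sphere\<close>

text \<open>
  Lebesgue measure of the linear subspace \<open>F\<close>, as a Borel measure on the ambient space that is
  concentrated on \<open>F\<close>: the image of the product Lebesgue measure under the coordinates of an
  orthonormal basis, exactly as \<^const>\<open>lborel\<close> is built from \<^const>\<open>Basis\<close>. By rotation
  invariance it does not depend on the orthonormal basis that is chosen.
\<close>
definition subspace_lborel :: "'a::euclidean_space set \<Rightarrow> 'a measure" where
  "subspace_lborel F =
     (let B = (SOME B. pairwise orthogonal B \<and> (\<forall>b\<in>B. norm b = 1) \<and> span B = F)
      in distr (\<Pi>\<^sub>M b\<in>B. lborel) borel (\<lambda>x. \<Sum>b\<in>B. x b *\<^sub>R b))"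

text \<open>
  Non-normalized surface measure on the unit sphere of the linear subspace \<open>E\<close>, in the usual polar
  coordinates form: a set \<open>A\<close> has measure \<open>dim E\<close> times the volume of the cone
  \<open>{t *\<^sub>R \<theta> | 0 < t \<le> 1 \<and> \<theta> \<in> A}\<close>. Here \<open>sgn x = x /\<^sub>R norm x\<close>.
\<close>
definition sphere_measure :: "'a::euclidean_space set \<Rightarrow> 'a measure" where
  "sphere_measure E =
     density
       (distr (restrict_space (subspace_lborel E) (E \<inter> cball 0 1 - {0}))
              (restrict_space borel (E \<inter> sphere 0 1)) sgn)
       (\<lambda>_. of_nat (dim E))"


section \<open>Grassmannians\<close>

definition grassmannian :: "'a::euclidean_space set \<Rightarrow> nat \<Rightarrow> 'a set set" where
  "grassmannian E m = {F. subspace F \<and> F \<subseteq> E \<and> dim F = m}"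

text \<open>
  On a linear subspace \<open>F\<close>, \<^term>\<open>closest_point F\<close> is the orthogonal projection onto \<open>F\<close>, so
  this is the usual topology, given by the distance \<open>norm (P\<^sub>F - P\<^sub>G)\<close> in operator norm.
\<close>
definition grassmannian_topology :: "'a::euclidean_space set \<Rightarrow> nat \<Rightarrow> 'a set topology" where
  "grassmannian_topology E m =
     pullback_topology (grassmannian E m) (\<lambda>F. Blinfun (closest_point F)) euclidean"

definition grassmannian_borel :: "'a::euclidean_space set \<Rightarrow> nat \<Rightarrow> 'a set measure" where
  "grassmannian_borel E m = sigma (grassmannian E m) {U. openin (grassmannian_topology E m) U}"

text \<open>
  The Haar probability measure on the \<open>m\<close>-dimensional subspaces of \<open>E\<close>: the unique Borel
  probability measure invariant under the orthogonal group of \<open>E\<close>. Every orthogonal map of \<open>E\<close>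
  is the restriction of an orthogonal map of the ambient space that preserves \<open>E\<close>.
\<close>
definition grassmannian_haar :: "'a::euclidean_space set \<Rightarrow> nat \<Rightarrow> 'a set measure" where
  "grassmannian_haar E m =
     (THE \<nu>. prob_space \<nu> \<and> sets \<nu> = sets (grassmannian_borel E m) \<and>
        (\<forall>T. orthogonal_transformation T \<and> T ` E = E \<longrightarrow> distr \<nu> \<nu> (\<lambda>F. T ` F) = \<nu>))"


section \<open>Star bodies\<close>

definition star_shaped_at_0 :: "'a::euclidean_space set \<Rightarrow> bool" where
  "star_shaped_at_0 K \<longleftrightarrow>
     compact K \<and> 0 \<in> interior K \<and>
     (\<forall>u. u \<noteq> 0 \<longrightarrow> (\<exists>a b. K \<inter> span {u} = closed_segment a b))"

definition radial_function :: "'a::euclidean_space set \<Rightarrow> 'a \<Rightarrow> real" where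
  "radial_function K \<theta> = (GREATEST t. 0 < t \<and> t *\<^sub>R \<theta> \<in> K)"

definition star_body :: "'a::euclidean_space set \<Rightarrow> bool" where
  "star_body K \<longleftrightarrow> star_shaped_at_0 K \<and> continuous_on (sphere 0 1) (radial_function K)"

definition origin_symmetric :: "'a::euclidean_space set \<Rightarrow> bool" where
  "origin_symmetric K \<longleftrightarrow> K = uminus ` K"


section \<open>Average section functional, intersection bodies, outer volume ratio distance\<close>

text \<open>
  The average volume of the \<open>r\<close>-codimensional central sections of \<open>L\<close>, computed inside the
  subspace \<open>E\<close>.
\<close>
definition avg_section :: "nat \<Rightarrow> 'a::euclidean_space set \<Rightarrow> 'a set \<Rightarrow> real" where
  "avg_section r E L =
     (LINT F|grassmannian_haar E (dim E - r). measure (subspace_lborel F) (L \<inter> F))"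

definition spherical_radon :: "('a::euclidean_space \<Rightarrow> real) \<Rightarrow> 'a set \<Rightarrow> real" where
  "spherical_radon g E = (LINT \<theta>|sphere_measure E. g \<theta>)"

definition gen_intersection_bodies :: "nat \<Rightarrow> 'a::euclidean_space set set" where
  "gen_intersection_bodies k =
     {D. star_body D \<and> origin_symmetric D \<and>
        (\<exists>\<mu>. finite_measure \<mu> \<and> sets \<mu> = sets (grassmannian_borel UNIV (DIM('a) - k)) \<and>
           (\<forall>g. continuous_on (sphere 0 1) g \<longrightarrow>
              (LINT \<theta>|sphere_measure UNIV. radial_function D \<theta> ^ k * g \<theta>) =
              (LINT H|\<mu>. spherical_radon g H)))}"

definition outer_volume_ratio_dist ::
  "'a::euclidean_space set \<Rightarrow> 'a set set \<Rightarrow> real" where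
  "outer_volume_ratio_dist K \<C> =
     Inf {(measure lborel D / measure lborel K) powr (1 / DIM('a)) | D. K \<subseteq> D \<and> D \<in> \<C>}"

end

theory Submission
  imports Defs
begin

text \<open>
  By polar coordinates, \<open>|K \<inter> F|\<close> is \<open>\<omega>\<^sub>m\<close> times the mean of \<open>\<rho>\<^sub>K ^ m\<close> over the unit sphere of
  the \<open>m\<close>-dimensional subspace \<open>F\<close>. Averaging over a random \<open>F \<subseteq> E\<close> turns \<open>as\<^sub>r(K \<inter> E)\<close> into
  \<open>\<omega>\<^sub>d\<close> times the mean of \<open>\<rho>\<^sub>K ^ d\<close> over the unit sphere of \<open>E\<close>, where \<open>d = dim E - r\<close>. If
  \<open>K \<subseteq> D\<close> and \<open>\<mu>\<^sub>D\<close> represents \<open>D\<close>, then \<open>\<rho>\<^sub>K ^ (n - r) \<le> \<rho>\<^sub>D ^ k * \<rho>\<^sub>K ^ (n - k - r)\<close>. The mean of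
  the right-hand side is an integral of \<open>as\<^sub>r(K \<inter> H)\<close> with respect to \<open>\<mu>\<^sub>D\<close>, and the total mass of
  \<open>\<mu>\<^sub>D\<close> is proportional to the mean of \<open>\<rho>\<^sub>D ^ k\<close>, which Jensen's inequality bounds by
  \<open>(|D| / \<omega>\<^sub>n) powr (k / n)\<close>.

  All uniqueness statements that are needed (Haar measure, rotation invariance of Lebesgue measure
  on a subspace, uniform measure on a sphere) are instances of one fact: a Borel measure for which
  balls of equal radius centred at points of its carrier have equal measure is determined by these
  values.
\<close>

section \<open>Uniformly distributed measures\<close>

text \<open>All spheres are sampled from one source: a uniformly distributed point of the ambient
  unit ball is projected onto F and normalised. F then enters only through the integrand, so
  measurability in F, continuity in F and averaging over F (Fubini) need no bases or charts. The
  same random points give Haar measure: Gram-Schmidt applied to m of them yields an invariant law,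
  so the \<open>THE\<close> in \<open>grassmannian_haar\<close> denotes. The maximum over E exists
  because sphere means of a continuous function depend continuously on a point of the compact
  Grassmannian. For the infimum no minimiser is at hand: the bound is shown for each admissible D
  and passes to the infimum by closedness, and balls show that some D is admissible. In the
  constant, \<omega> of index n-r converts the mean of the (n-r)-th power of the radial function
  into as_r(K), division by \<omega> of index n-k-r undoes the same conversion for sections, and the
  power of \<omega> of index n is the normalisation in Jensen's inequality; surface areas
  cancel.\<close>

lemma measurable_near_pairs:
  fixes M N :: "'a::{metric_space,second_countable_topology} measure"
  assumes [measurable_cong]: "sets M = sets borel" "sets N = sets borel"
  shows "{p. dist (fst p) (snd p) \<le> r} \<in> sets (M \<Otimes>\<^sub>M N)"
proof -
  have "closed {p :: 'a \<times> 'a. dist (fst p) (snd p) \<le> r}"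
    by (intro closed_Collect_le continuous_intros)
  then have "{p :: 'a \<times> 'a. dist (fst p) (snd p) \<le> r} \<in> sets borel" by simp
  also have "sets (borel :: ('a \<times> 'a) measure) = sets (borel \<Otimes>\<^sub>M borel)" by (simp only: borel_prod)
  also have "\<dots> = sets (M \<Otimes>\<^sub>M N)" by (intro sets_pair_measure_cong) (simp_all add: assms)
  finally show ?thesis .
qed

text \<open>Both sides are the product measure of the pairs at distance at most \<open>r\<close>
  with first entry in \<open>C\<close>. This double count is the only device behind the uniqueness
  results.\<close>

lemma nn_integral_near_swap:
  fixes M N :: "'a::{metric_space,second_countable_topology} measure"
  assumes sets: "sets M = sets borel" "sets N = sets borel"
    and "sigma_finite_measure M" "sigma_finite_measure N"
    and C: "C \<in> sets borel"
  shows "(\<integral>\<^sup>+x. indicator C x * emeasure N (cball x r) \<partial>M) =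
         (\<integral>\<^sup>+y. emeasure M (C \<inter> cball y r) \<partial>N)"
proof -
  interpret M: sigma_finite_measure M by fact
  interpret N: sigma_finite_measure N by fact
  interpret pair_sigma_finite M N ..
  note [measurable_cong] = sets
  note [measurable] = measurable_near_pairs[OF sets, of r] C
  let ?S = "{p :: 'a \<times> 'a. dist (fst p) (snd p) \<le> r}"
  have "(\<integral>\<^sup>+x. indicator C x * emeasure N (cball x r) \<partial>M) =
        (\<integral>\<^sup>+x. \<integral>\<^sup>+y. indicator C x * indicator ?S (x, y) \<partial>N \<partial>M)"
  proof (intro nn_integral_cong)
    fix x
    have "(\<integral>\<^sup>+y. indicator C x * indicator ?S (x, y) \<partial>N) =
          (\<integral>\<^sup>+y. indicator C x * indicator (cball x r) y \<partial>N)"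
      by (intro nn_integral_cong) (auto simp: indicator_def)
    also have "\<dots> = indicator C x * emeasure N (cball x r)"
      by (intro nn_integral_cmult_indicator) (simp add: sets)
    finally show "indicator C x * emeasure N (cball x r) =
        (\<integral>\<^sup>+y. indicator C x * indicator ?S (x, y) \<partial>N)" by simp
  qed
  also have "\<dots> = (\<integral>\<^sup>+y. \<integral>\<^sup>+x. indicator C x * indicator ?S (x, y) \<partial>M \<partial>N)"
    by (rule Fubini'[symmetric]) measurable
  also have "\<dots> = (\<integral>\<^sup>+y. emeasure M (C \<inter> cball y r) \<partial>N)"
  proof (intro nn_integral_cong)
    fix y
    have "(\<integral>\<^sup>+x. indicator C x * indicator ?S (x, y) \<partial>M) =
          (\<integral>\<^sup>+x. indicator (C \<inter> cball y r) x \<partial>M)"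
      by (intro nn_integral_cong) (auto simp: indicator_def dist_commute)
    also have "\<dots> = emeasure M (C \<inter> cball y r)" using C by (subst nn_integral_indicator) (auto simp: sets)
    finally show "(\<integral>\<^sup>+x. indicator C x * indicator ?S (x, y) \<partial>M) = emeasure M (C \<inter> cball y r)" .
  qed
  finally show ?thesis .
qed

lemma Union_cball_Suc: "(\<Union>i::nat. cball x (real i + 1)) = UNIV"
proof (intro set_eqI iffI UNIV_I)
  fix y
  obtain i :: nat where "dist x y \<le> real i" using real_arch_simple by blast
  then show "y \<in> (\<Union>i::nat. cball x (real i + 1))" by (auto intro!: exI[of _ i])
qed

lemma sigma_finite_measure_cballs:
  fixes M :: "'a::metric_space measure"
  assumes "sets M = sets borel" "\<And>r. 0 < r \<Longrightarrow> emeasure M (cball x r) \<noteq> \<infinity>"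
  shows "sigma_finite_measure M"
proof
  show "\<exists>A. countable A \<and> A \<subseteq> sets M \<and> \<Union> A = space M \<and> (\<forall>a\<in>A. emeasure M a \<noteq> \<infinity>)"
    using assms by (intro exI[of _ "range (\<lambda>i::nat. cball x (real i + 1))"])
      (auto simp: sets_eq_imp_space_eq[OF assms(1)] add_nonneg_pos Union_cball_Suc)
qed

text \<open>In the double count each x in \<open>C\<close> contributes \<open>a r\<close>, while
  each y contributes at most \<open>a r\<close>, and nothing unless it lies within \<open>r\<close>
  of \<open>C\<close>. Cancelling \<open>a r\<close> bounds \<open>M C\<close> by the
  \<open>N\<close>-measure of the closed \<open>r\<close>-neighbourhood of \<open>C\<close>, and
  these neighbourhoods shrink to \<open>C\<close>.\<close>

lemma uniform_measure_closed_le: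
  fixes M N :: "'a::{metric_space,second_countable_topology} measure"
  assumes sets: "sets M = sets borel" "sets N = sets borel"
    and X: "AE x in M. x \<in> X" "AE x in N. x \<in> X" "x0 \<in> X"
    and M: "\<And>x r. x \<in> X \<Longrightarrow> 0 < r \<Longrightarrow> emeasure M (cball x r) = a r"
    and N: "\<And>x r. x \<in> X \<Longrightarrow> 0 < r \<Longrightarrow> emeasure N (cball x r) = a r"
    and a: "\<And>r. 0 < r \<Longrightarrow> a r \<noteq> 0" "\<And>r. 0 < r \<Longrightarrow> a r \<noteq> (\<infinity>::ennreal)"
    and C: "closed C" "bounded C"
  shows "emeasure M C \<le> emeasure N C"
proof (cases "C = {}")
  case False
  interpret M: sigma_finite_measure M
    using sigma_finite_measure_cballs[of M x0] sets M[OF X(3)] a by simp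
  interpret N: sigma_finite_measure N
    using sigma_finite_measure_cballs[of N x0] sets N[OF X(3)] a by simp
  note [measurable_cong] = sets
  have CM: "C \<in> sets M" using C sets by simp
  define D where "D r = {y. infdist y C \<le> r}" for r
  have clD: "closed (D r)" for r
    unfolding D_def by (intro closed_Collect_le continuous_intros)
  then have D: "D r \<in> sets N" for r using sets by simp
  have le: "emeasure M C \<le> emeasure N (D r)" if r: "0 < r" for r
  proof -
    have "a r * emeasure M C = (\<integral>\<^sup>+x. a r * indicator C x \<partial>M)"
      using CM by (simp add: nn_integral_cmult_indicator)
    also have "\<dots> = (\<integral>\<^sup>+x. indicator C x * emeasure N (cball x r) \<partial>M)"
      using X(1) N r by (intro nn_integral_cong_AE) (auto simp: mult.commute)
    also have "\<dots> = (\<integral>\<^sup>+y. emeasure M (C \<inter> cball y r) \<partial>N)"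
      using C sets by (intro nn_integral_near_swap) (auto simp: M.sigma_finite_measure_axioms N.sigma_finite_measure_axioms)
    also have "\<dots> \<le> (\<integral>\<^sup>+y. a r * indicator (D r) y \<partial>N)"
    proof (intro nn_integral_mono_AE, use X(2) in eventually_elim)
      fix y assume y: "y \<in> X"
      have "emeasure M (C \<inter> cball y r) \<le> emeasure M (cball y r)"
        by (intro emeasure_mono) (auto simp: sets)
      moreover have "C \<inter> cball y r = {}" if "y \<notin> D r"
      proof (rule ccontr)
        assume "C \<inter> cball y r \<noteq> {}"
        then obtain c where "c \<in> C" "dist y c \<le> r" by auto
        then have "infdist y C \<le> r" by (meson infdist_le order_trans)
        then show False using that by (simp add: D_def)
      qed
      ultimately show "emeasure M (C \<inter> cball y r) \<le> a r * indicator (D r) y"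
        using M[OF y r] by (cases "y \<in> D r") auto
    qed
    also have "\<dots> = a r * emeasure N (D r)"
      using D by (simp add: nn_integral_cmult_indicator)
    finally show ?thesis
      using a[OF r] by (simp add: ennreal_mult_le_mult_iff)
  qed
  have "(\<Inter>n::nat. D (1 / real (Suc n))) = C"
  proof
    show "C \<subseteq> (\<Inter>n::nat. D (1 / real (Suc n)))" by (auto simp: D_def)
    show "(\<Inter>n::nat. D (1 / real (Suc n))) \<subseteq> C"
    proof
      fix y assume "y \<in> (\<Inter>n::nat. D (1 / real (Suc n)))"
      then have y: "infdist y C \<le> 1 / real (Suc n)" for n by (auto simp: D_def)
      have "infdist y C \<le> 0"
      proof (rule ccontr)
        assume "\<not> infdist y C \<le> 0"
        then obtain n where "1 / real (Suc n) < infdist y C"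
          using nat_approx_posE by (metis not_le)
        then show False using y[of n] by simp
      qed
      then show "y \<in> C"
        using in_closed_iff_infdist_zero[OF C(1) False] infdist_nonneg[of y C] by simp
    qed
  qed
  moreover have "(\<lambda>n. emeasure N (D (1 / real (Suc n)))) \<longlonglongrightarrow> emeasure N (\<Inter>n. D (1 / real (Suc n)))"
  proof (rule Lim_emeasure_decseq)
    show "range (\<lambda>n. D (1 / real (Suc n))) \<subseteq> sets N" using D by auto
    show "decseq (\<lambda>n. D (1 / real (Suc n)))"
      unfolding decseq_def D_def
      by (auto elim!: order_trans simp: frac_le)
    fix n
    obtain R where R: "\<And>c. c \<in> C \<Longrightarrow> dist x0 c \<le> R" using C(2) by (meson bounded_any_center)
    obtain c0 where "c0 \<in> C" using False by auto
    with R have R0: "0 \<le> R" using zero_le_dist order_trans by blast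
    \<comment> \<open>Continuity from above needs finite measure, hence a surrounding ball. Any
      number above 1 could replace the 2: the strict inequality is what produces an actual point of
      \<open>C\<close> near y.\<close>
    have "D (1 / real (Suc n)) \<subseteq> cball x0 (R + 2)"
    proof
      fix y assume "y \<in> D (1 / real (Suc n))"
      then have "infdist y C \<le> 1 / real (Suc n)" by (simp add: D_def)
      also have "\<dots> < 2" by (simp add: field_simps)
      finally have "infdist y C < 2" .
      then obtain c where "c \<in> C" "dist y c < 2"
        using False infdist_notempty[OF False, of y] cInf_less_iff[of "dist y ` C" 2]
        by (auto simp: bdd_below.I2[of _ 0])
      then have "dist x0 y \<le> R + 2" using R[of c] dist_triangle[of x0 y c] by (simp add: dist_commute)
      then show "y \<in> cball x0 (R + 2)" by simp
    qed
    then have "emeasure N (D (1 / real (Suc n))) \<le> emeasure N (cball x0 (R + 2))"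
      by (intro emeasure_mono) (auto simp: sets)
    also have "\<dots> < \<infinity>" using N[OF X(3), of "R+2"] a(2)[of "R + 2"] R0 by (auto simp: less_top)
    finally show "emeasure N (D (1 / real (Suc n))) \<noteq> \<infinity>" by simp
  qed
  ultimately have "(\<lambda>n. emeasure N (D (1 / real (Suc n)))) \<longlonglongrightarrow> emeasure N C" by simp
  then show ?thesis
    by (rule LIMSEQ_le_const) (use le in auto)
qed simp

text \<open>The one-sided estimate applies in both directions. Closed bounded sets form an
  intersection-stable generator, exhausted by balls of finite measure.\<close>

theorem uniformly_distributed_measure_eqI:
  fixes M N :: "'a::{metric_space,second_countable_topology} measure"
  assumes sets: "sets M = sets borel" "sets N = sets borel"
    and X: "AE x in M. x \<in> X" "AE x in N. x \<in> X" "x0 \<in> X"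
    and M: "\<And>x r. x \<in> X \<Longrightarrow> 0 < r \<Longrightarrow> emeasure M (cball x r) = a r"
    and N: "\<And>x r. x \<in> X \<Longrightarrow> 0 < r \<Longrightarrow> emeasure N (cball x r) = a r"
    and a: "\<And>r. 0 < r \<Longrightarrow> a r \<noteq> 0" "\<And>r. 0 < r \<Longrightarrow> a r \<noteq> (\<infinity>::ennreal)"
  shows "M = N"
proof (rule measure_eqI_generator_eq[where E = "{C. closed C \<and> bounded C}" and \<Omega> = UNIV
        and A = "\<lambda>i. cball x0 (real i + 1)"])
  show "Int_stable {C :: 'a set. closed C \<and> bounded C}"
    by (auto simp: Int_stable_def)
  show "emeasure M C = emeasure N C" if "C \<in> {C. closed C \<and> bounded C}" for C
    using that assms uniform_measure_closed_le[of M N X x0 a C] uniform_measure_closed_le[of N M X x0 a C]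
    by (intro antisym) auto
  have "sigma_sets UNIV {C :: 'a set. closed C \<and> bounded C} = sets borel"
  proof
    show "sigma_sets UNIV {C :: 'a set. closed C \<and> bounded C} \<subseteq> sets borel"
      by (rule sets.sigma_sets_subset[of _ borel, simplified]) auto
    have "closed C \<Longrightarrow> C \<in> sigma_sets UNIV {C :: 'a set. closed C \<and> bounded C}" for C
    proof -
      assume C: "closed C"
      have "(\<Union>i::nat. C \<inter> cball x0 (real i + 1)) \<in> sigma_sets UNIV {C :: 'a set. closed C \<and> bounded C}"
        using C by (intro sigma_sets_UNION) (auto intro!: sigma_sets.Basic)
      also have "(\<Union>i::nat. C \<inter> cball x0 (real i + 1)) = C" using Union_cball_Suc[of x0] by blast
      finally show ?thesis .
    qed
    then show "sets borel \<subseteq> sigma_sets UNIV {C :: 'a set. closed C \<and> bounded C}"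
      unfolding borel_eq_closed
      by (subst sets_measure_of) (auto intro!: sigma_sets_mono)
  qed
  then show "sets M = sigma_sets UNIV {C. closed C \<and> bounded C}"
    "sets N = sigma_sets UNIV {C. closed C \<and> bounded C}" using sets by auto
  show "(\<Union>i::nat. cball x0 (real i + 1)) = UNIV" by (rule Union_cball_Suc)
  show "emeasure M (cball x0 (real i + 1)) \<noteq> \<infinity>" for i :: nat
    using M[OF X(3), of "real i + 1"] a(2)[of "real i + 1"] by simp
qed auto

text \<open>For equal finite total mass it suffices that each measure is uniform by itself: the
  double count over the whole space forces the two ball functions to coincide. This is the form
  suited to compact homogeneous spaces, where transitivity gives uniformity.\<close>

corollary uniformly_distributed_finite_measure_eqI:
  fixes M N :: "'a::{metric_space,second_countable_topology} measure"
  assumes sets: "sets M = sets borel" "sets N = sets borel"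
    and fin: "emeasure M UNIV = c" "emeasure N UNIV = c" "c \<noteq> 0" "c \<noteq> \<infinity>"
    and X: "AE x in M. x \<in> X" "AE x in N. x \<in> X" "compact X"
    and M: "\<And>x y r. x \<in> X \<Longrightarrow> y \<in> X \<Longrightarrow> 0 < r \<Longrightarrow> emeasure M (cball x r) = emeasure M (cball y r)"
    and N: "\<And>x y r. x \<in> X \<Longrightarrow> y \<in> X \<Longrightarrow> 0 < r \<Longrightarrow> emeasure N (cball x r) = emeasure N (cball y r)"
  shows "M = N"
proof -
  have sp: "space M = UNIV" "space N = UNIV" using sets[THEN sets_eq_imp_space_eq] by auto
  interpret M: finite_measure M using fin by (auto intro!: finite_measureI simp: sp)
  interpret N: finite_measure N using fin by (auto intro!: finite_measureI simp: sp)
  have XM: "X \<in> sets M" using \<open>compact X\<close> sets by (simp add: compact_imp_closed)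
  have eX: "emeasure M X = c"
    using emeasure_eq_AE[where M = M and A = X and B = UNIV] X(1) XM fin(1) sets by auto
  then have "X \<noteq> {}" using fin(3) by auto
  then obtain x0 where x0: "x0 \<in> X" by auto
  \<comment> \<open>Were one such ball null, all would be, and finitely many of them cover the
    compact \<open>X\<close>, which carries the whole mass.\<close>
  have pos: "emeasure M (cball x0 r) \<noteq> 0" if r: "0 < r" for r
  proof
    assume z: "emeasure M (cball x0 r) = 0"
    have "X \<subseteq> (\<Union>x\<in>X. ball x r)" using r by auto
    with compactE_image[OF \<open>compact X\<close>, of X "\<lambda>x. ball x r"]
    obtain k where k: "finite k" "k \<subseteq> X" "X \<subseteq> (\<Union>x\<in>k. ball x r)"
      by (metis open_ball)
    have "emeasure M X \<le> emeasure M (\<Union>x\<in>k. cball x r)"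
      using k by (intro emeasure_mono) (force simp: sets ball_def cball_def)+
    also have "\<dots> \<le> (\<Sum>x\<in>k. emeasure M (cball x r))"
      using k by (intro emeasure_subadditive_finite) (auto simp: sets)
    also have "\<dots> = (\<Sum>x\<in>k. 0)"
      using k z M[OF _ x0 r] by (intro sum.cong) (auto)
    finally show False using eX fin(3) by simp
  qed
  have eq: "emeasure N (cball x0 r) = emeasure M (cball x0 r)" if r: "0 < r" for r
  proof -
    have "emeasure N (cball x0 r) * c = (\<integral>\<^sup>+x. emeasure N (cball x0 r) \<partial>M)" by (simp add: sp fin)
    also have "\<dots> = (\<integral>\<^sup>+x. indicator UNIV x * emeasure N (cball x r) \<partial>M)"
      using X(1) N[OF x0 _ r] by (intro nn_integral_cong_AE) auto
    also have "\<dots> = (\<integral>\<^sup>+y. emeasure M (UNIV \<inter> cball y r) \<partial>N)"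
      using sets by (intro nn_integral_near_swap) (auto simp: M.sigma_finite_measure_axioms N.sigma_finite_measure_axioms)
    also have "\<dots> = (\<integral>\<^sup>+y. emeasure M (cball x0 r) \<partial>N)"
      using X(2) M[OF x0 _ r] by (intro nn_integral_cong_AE) auto
    also have "\<dots> = emeasure M (cball x0 r) * c" by (simp add: sp fin)
    finally show ?thesis using fin(3,4) by (simp add: mult.commute[of _ c] ennreal_mult_cancel_left)
  qed
  show ?thesis
  proof (rule uniformly_distributed_measure_eqI[OF sets X(1,2) x0, where a = "\<lambda>r. emeasure M (cball x0 r)"])
    show "emeasure M (cball x r) = emeasure M (cball x0 r)" if "x \<in> X" "0 < r" for x r
      by (rule M[OF that(1) x0 that(2)])
    show "emeasure N (cball x r) = emeasure M (cball x0 r)" if "x \<in> X" "0 < r" for x r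
      by (rule trans[OF N[OF that(1) x0 that(2)] eq[OF that(2)]])
  qed (use pos in auto)
qed

section \<open>Orthogonal projections as points of the Grassmannian\<close>

lemma
  fixes F :: "'a::euclidean_space set"
  assumes "subspace F"
  shows closest_point_in_subspace: "closest_point F x \<in> F"
    and closest_point_orthogonal: "y \<in> F \<Longrightarrow> (x - closest_point F x) \<bullet> y = 0"
proof -
  have cl: "closed F" "convex F" "F \<noteq> {}"
    using assms by (auto simp: closed_subspace subspace_imp_convex dest: subspace_0)
  show in_F: "closest_point F x \<in> F" for x using closest_point_in_set cl by auto
  assume y: "y \<in> F"
  have "(x - closest_point F x) \<bullet> z \<le> 0" if "z \<in> F" for z
    using closest_point_dot[OF cl(2,1) subspace_add[OF assms in_F that], of x x] by simp
  from this[OF y] this[OF subspace_neg[OF assms y]]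
  show "(x - closest_point F x) \<bullet> y = 0" by simp
qed

lemma closest_point_subspace_eqI:
  fixes F :: "'a::euclidean_space set"
  assumes F: "subspace F" and p: "p \<in> F" "\<And>y. y \<in> F \<Longrightarrow> (x - p) \<bullet> y = 0"
  shows "closest_point F x = p"
proof -
  let ?d = "closest_point F x - p"
  have "?d \<in> F" using closest_point_in_subspace[OF F] p F by (simp add: subspace_diff)
  then have "(x - p) \<bullet> ?d = 0" "(x - closest_point F x) \<bullet> ?d = 0"
    using p closest_point_orthogonal[OF F] by auto
  then have "?d \<bullet> ?d = 0" by (simp add: algebra_simps)
  then show ?thesis by simp
qed

lemma linear_closest_point:
  fixes F :: "'a::euclidean_space set"
  assumes F: "subspace F"
  shows "linear (closest_point F)"
proof
  note * = closest_point_in_subspace[OF F] closest_point_orthogonal[OF F]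
  show "closest_point F (x + y) = closest_point F x + closest_point F y" for x y
  proof (rule closest_point_subspace_eqI[OF F])
    fix z assume "z \<in> F"
    with *(2)[of z x] *(2)[of z y]
    show "(x + y - (closest_point F x + closest_point F y)) \<bullet> z = 0"
      by (simp add: algebra_simps)
  qed (simp add: * subspace_add[OF F])
  show "closest_point F (c *\<^sub>R x) = c *\<^sub>R closest_point F x" for c x
  proof (rule closest_point_subspace_eqI[OF F])
    fix z assume "z \<in> F"
    with *(2)[of z x]
    show "(c *\<^sub>R x - c *\<^sub>R closest_point F x) \<bullet> z = 0"
      by (simp flip: scaleR_diff_right)
  qed (simp add: * subspace_scale[OF F])
qed

text \<open>This is the map pulled back in \<open>grassmannian_topology\<close>; it turns subspaces
  into points of a normed space of operators.\<close>

definition proj :: "'a::euclidean_space set \<Rightarrow> 'a \<Rightarrow>\<^sub>L 'a" where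
  "proj F = Blinfun (closest_point F)"

lemma proj_apply: "subspace F \<Longrightarrow> blinfun_apply (proj F) x = closest_point F x"
  unfolding proj_def
  by (simp add: bounded_linear_Blinfun_apply linear_closest_point linear_conv_bounded_linear[symmetric])

lemma proj_in: "subspace F \<Longrightarrow> blinfun_apply (proj F) x \<in> F"
  by (simp add: proj_apply closest_point_in_subspace)

lemma proj_orthogonal: "subspace F \<Longrightarrow> y \<in> F \<Longrightarrow> (x - blinfun_apply (proj F) x) \<bullet> y = 0"
  by (simp add: proj_apply closest_point_orthogonal)

lemma proj_apply_eqI:
  "subspace F \<Longrightarrow> p \<in> F \<Longrightarrow> (\<And>y. y \<in> F \<Longrightarrow> (x - p) \<bullet> y = 0) \<Longrightarrow> blinfun_apply (proj F) x = p"
  by (simp add: proj_apply closest_point_subspace_eqI)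

lemma proj_eqI:
  "subspace F \<Longrightarrow> (\<And>x. blinfun_apply P x \<in> F) \<Longrightarrow>
    (\<And>x y. y \<in> F \<Longrightarrow> (x - blinfun_apply P x) \<bullet> y = 0) \<Longrightarrow> proj F = P"
  by (intro blinfun_eqI proj_apply_eqI)

lemma proj_id_iff: "subspace F \<Longrightarrow> blinfun_apply (proj F) x = x \<longleftrightarrow> x \<in> F"
  using proj_in[of F x] proj_apply_eqI[of F x x] by (metis diff_self inner_zero_left)

lemma range_proj: "subspace F \<Longrightarrow> range (blinfun_apply (proj F)) = F"
  using proj_in[of F] proj_id_iff[of F] by (auto simp: image_iff) metis

lemma inner_proj:
  assumes "subspace F"
  shows "blinfun_apply (proj F) x \<bullet> y = x \<bullet> blinfun_apply (proj F) y"
proof -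
  have "x \<bullet> blinfun_apply (proj F) y = blinfun_apply (proj F) x \<bullet> blinfun_apply (proj F) y"
    "y \<bullet> blinfun_apply (proj F) x = blinfun_apply (proj F) y \<bullet> blinfun_apply (proj F) x"
    using proj_orthogonal[OF assms proj_in[OF assms, of y], of x]
      proj_orthogonal[OF assms proj_in[OF assms, of x], of y]
    by (simp_all add: inner_diff_left)
  then show ?thesis by (metis inner_commute)
qed

lemma norm_proj_le: "subspace F \<Longrightarrow> norm (blinfun_apply (proj F) x) \<le> norm x"
proof -
  assume F: "subspace F"
  have "(norm (blinfun_apply (proj F) x))\<^sup>2 = x \<bullet> blinfun_apply (proj F) x"
    using proj_orthogonal[OF F proj_in[OF F, of x], of x]
    by (simp add: power2_norm_eq_inner inner_diff_left)
  also have "\<dots> \<le> norm x * norm (blinfun_apply (proj F) x)" by (rule norm_cauchy_schwarz)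
  finally show ?thesis
    by (metis mult_right_le_imp_le norm_ge_zero order_le_less power2_eq_square)
qed

lemma norm_blinfun_proj_le: "subspace F \<Longrightarrow> norm (proj F) \<le> 1"
  by (rule norm_blinfun_bound) (use norm_proj_le in auto)

text \<open>Expanding the projection in an orthonormal basis of \<open>F\<close> and swapping the
  sums leaves one unit norm per basis vector. The gain is that the dimension becomes a continuous
  function of the operator.\<close>

lemma trace_proj:
  fixes F :: "'a::euclidean_space set"
  assumes F: "subspace F"
  shows "(\<Sum>b\<in>Basis. blinfun_apply (proj F) b \<bullet> b) = real (dim F)"
proof -
  obtain B where B: "B \<subseteq> F" "pairwise orthogonal B" "\<And>x. x \<in> B \<Longrightarrow> norm x = 1"
    "independent B" "card B = dim F" "span B = F"
    using orthonormal_basis_subspace[OF F] by blast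
  have fin: "finite B" using B independent_imp_finite by blast
  have P: "blinfun_apply (proj F) x = (\<Sum>c\<in>B. (x \<bullet> c) *\<^sub>R c)" for x
  proof (rule proj_apply_eqI[OF F])
    show "(\<Sum>c\<in>B. (x \<bullet> c) *\<^sub>R c) \<in> F" using B(1) F by (intro subspace_sum subspace_scale) auto
    fix y assume "y \<in> F"
    then have "y \<in> span B" using B by simp
    then have "orthogonal (x - (\<Sum>c\<in>B. (x \<bullet> c) *\<^sub>R c)) y"
    proof (rule orthogonal_to_span)
      fix d assume d: "d \<in> B"
      have "(\<Sum>c\<in>B. (x \<bullet> c) * (c \<bullet> d)) = (\<Sum>c\<in>B. if c = d then x \<bullet> d else 0)"
        using B(2,3) d by (intro sum.cong) (auto simp: pairwise_def orthogonal_def norm_eq_1)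
      then show "orthogonal (x - (\<Sum>c\<in>B. (x \<bullet> c) *\<^sub>R c)) d"
        using d fin by (simp add: orthogonal_def inner_diff_left inner_sum_left)
    qed
    then show "(x - (\<Sum>c\<in>B. (x \<bullet> c) *\<^sub>R c)) \<bullet> y = 0" by (simp add: orthogonal_def)
  qed
  have "(\<Sum>b\<in>Basis. blinfun_apply (proj F) b \<bullet> b) = (\<Sum>b\<in>Basis. \<Sum>c\<in>B. (c \<bullet> b)\<^sup>2)"
    unfolding P inner_sum_left inner_scaleR_left power2_eq_square
    by (intro sum.cong refl) (simp add: inner_commute)
  also have "\<dots> = (\<Sum>c\<in>B. \<Sum>b\<in>Basis. (c \<bullet> b)\<^sup>2)" by (rule sum.swap)
  also have "\<dots> = (\<Sum>c\<in>B. (norm c)\<^sup>2)"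
    by (intro sum.cong refl, unfold power2_norm_eq_inner, subst euclidean_inner)
      (simp add: power2_eq_square)
  also have "\<dots> = real (dim F)" using B by simp
  finally show ?thesis .
qed

text \<open>The uniqueness results assume second countability, so this opens them to measures on
  projections. Closed balls of operators are compact, and their finite nets of mesh
  \<open>1 / Suc j\<close> supply the centres of a countable basis.\<close>

instance blinfun :: (euclidean_space, euclidean_space) second_countable_topology
proof
  have "\<exists>k. finite k \<and> cball (0 :: 'a \<Rightarrow>\<^sub>L 'b) (real n) \<subseteq> (\<Union>x\<in>k. ball x (1 / real (Suc j)))" for n j :: nat
    using compact_cball[of "0 :: 'a \<Rightarrow>\<^sub>L 'b" "real n", unfolded compact_eq_totally_bounded]
    by simp
  then obtain D where D: "\<And>n j. finite (D n j)"
    "\<And>n j. cball (0 :: 'a \<Rightarrow>\<^sub>L 'b) (real n) \<subseteq> (\<Union>x\<in>D n j. ball x (1 / real (Suc j)))"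
    by metis
  let ?B = "\<Union>n j. (\<lambda>x. ball x (1 / real (Suc j))) ` D n j"
  have "countable ?B" using D(1) by (auto intro!: countable_UN simp: countable_finite)
  moreover have "topological_basis ?B"
  proof (rule topological_basisI)
    fix U :: "('a \<Rightarrow>\<^sub>L 'b) set" and x
    assume "open U" "x \<in> U"
    then obtain e where e: "e > 0" "ball x e \<subseteq> U" using open_contains_ball by blast
    obtain j where j: "1 / real (Suc j) < e / 2" using nat_approx_posE[of "e/2"] e by auto
    obtain n :: nat where "norm x \<le> real n" using real_arch_simple by blast
    then have "x \<in> cball 0 (real n)" by simp
    with D(2) obtain y where y: "y \<in> D n j" "x \<in> ball y (1 / real (Suc j))" by blast
    have "ball y (1 / real (Suc j)) \<subseteq> ball x e"
    proof
      fix z assume "z \<in> ball y (1 / real (Suc j))"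
      then show "z \<in> ball x e"
        using y(2) j dist_triangle[of x z y] by (simp add: dist_commute)
    qed
    then show "\<exists>B'\<in>?B. x \<in> B' \<and> B' \<subseteq> U" using y e(2) by blast
  qed auto
  ultimately show "\<exists>B :: ('a \<Rightarrow>\<^sub>L 'b) set set. countable B \<and> open = generate_topology B"
    by (intro exI[of _ ?B] conjI topological_basis_imp_subbasis)
qed

section \<open>The Grassmannian as a compact set of projections\<close>

lemma grassmannianD:
  "F \<in> grassmannian E m \<Longrightarrow> subspace F" "F \<in> grassmannian E m \<Longrightarrow> F \<subseteq> E"
  "F \<in> grassmannian E m \<Longrightarrow> dim F = m"
  by (auto simp: grassmannian_def)

lemma grassmannian_nonempty:
  fixes E :: "'a::euclidean_space set"
  assumes "subspace E" "m \<le> dim E"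
  shows "grassmannian E m \<noteq> {}"
proof -
  obtain F where "subspace F" "F \<subseteq> span E" "dim F = m"
    by (rule choose_subspace_of_subspace[OF assms(2)])
  then have "F \<in> grassmannian E m"
    using span_eq_iff[THEN iffD2, OF assms(1)] by (simp add: grassmannian_def)
  then show ?thesis by blast
qed

text \<open>The image consists of the self-adjoint idempotents with range in \<open>E\<close> and
  trace \<open>m\<close>. These are closed conditions on the operator, the dimension being read off
  as the trace, and projections have norm at most 1.\<close>

lemma compact_proj_grassmannian:
  fixes E :: "'a::euclidean_space set"
  assumes E: "subspace E"
  shows "compact (proj ` grassmannian E m)"
proof -
  let ?S = "{P :: 'a \<Rightarrow>\<^sub>L 'a. (\<forall>x. blinfun_apply P (blinfun_apply P x) = blinfun_apply P x) \<and>
     (\<forall>x y. blinfun_apply P x \<bullet> y = x \<bullet> blinfun_apply P y) \<and> (\<forall>x. blinfun_apply P x \<in> E) \<and>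
     (\<Sum>b\<in>Basis. blinfun_apply P b \<bullet> b) = real m}"
  have "proj ` grassmannian E m = ?S"
  proof (intro equalityI subsetI)
    fix P assume "P \<in> proj ` grassmannian E m"
    then obtain F where F: "P = proj F" "subspace F" "F \<subseteq> E" "dim F = m"
      by (auto simp: grassmannian_def)
    then show "P \<in> ?S"
      using inner_proj[OF F(2)] proj_in[OF F(2)] proj_id_iff[OF F(2)] trace_proj[OF F(2)] by auto
  next
    fix P assume P: "P \<in> ?S"
    let ?F = "range (blinfun_apply P)"
    have F: "subspace ?F"
      by (intro linear_subspace_image) (simp_all add: linear_conv_bounded_linear blinfun.bounded_linear_right)
    have PF: "proj ?F = P"
    proof (rule proj_eqI[OF F])
      fix x y assume "y \<in> ?F"
      then obtain z where "y = blinfun_apply P z" by auto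
      then show "(x - blinfun_apply P x) \<bullet> y = 0"
        using P by (simp add: inner_diff_left)
    qed auto
    have "?F \<in> grassmannian E m"
      using F P trace_proj[OF F] by (auto simp: grassmannian_def PF)
    then show "P \<in> proj ` grassmannian E m" using PF by (metis image_eqI)
  qed
  moreover have "closed ?S"
  proof (intro closed_Collect_conj closed_Collect_all closed_Collect_eq continuous_intros)
    fix x
    have "closed ((\<lambda>P :: 'a \<Rightarrow>\<^sub>L 'a. blinfun_apply P x) -` E)"
      by (intro closed_vimage closed_subspace E continuous_intros)
    then show "closed {P :: 'a \<Rightarrow>\<^sub>L 'a. blinfun_apply P x \<in> E}" by (simp add: vimage_def)
  qed
  moreover have "bounded (proj ` grassmannian E m)"
    by (rule boundedI[where B = 1]) (auto simp: norm_blinfun_proj_le grassmannianD)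
  ultimately show ?thesis by (simp add: compact_eq_bounded_closed)
qed

section \<open>The action of orthogonal maps on vectors and subspaces\<close>

lemma orthogonal_transformation_bounded_linear: "orthogonal_transformation T \<Longrightarrow> bounded_linear T"
  for T :: "'a::euclidean_space \<Rightarrow> 'a"
  by (simp add: linear_conv_bounded_linear[symmetric] orthogonal_transformation_linear)

lemma borel_measurable_orthogonal_transformation [measurable (raw)]:
  fixes T :: "'a::euclidean_space \<Rightarrow> 'a"
  assumes "orthogonal_transformation T"
  shows "T \<in> borel_measurable borel"
  using orthogonal_transformation_bounded_linear[OF assms]
  by (intro borel_measurable_continuous_onI linear_continuous_on)

lemma orthogonal_transformation_dist:
  "orthogonal_transformation T \<Longrightarrow> dist (T x) (T y) = dist x y"
  by (metis dist_norm linear_diff orthogonal_transformation)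

lemma orthogonal_transformation_sgn:
  "orthogonal_transformation T \<Longrightarrow> sgn (T x) = T (sgn x)"
  by (simp add: sgn_div_norm orthogonal_transformation_norm orthogonal_transformation_scaleR)

lemma orthogonal_transformation_vimage_cball:
  fixes T :: "'a::euclidean_space \<Rightarrow> 'a"
  assumes "orthogonal_transformation T"
  shows "T -` cball (T x) r = cball x r"
  using orthogonal_transformation_dist[OF assms] by auto

lemma orthogonal_transformation_inv_inv:
  fixes T :: "'a::euclidean_space \<Rightarrow> 'a"
  assumes "orthogonal_transformation T"
  shows "T (inv T x) = x" "inv T (T x) = x"
  using orthogonal_transformation_bij[OF assms]
  by (auto simp: bij_def surj_f_inv_f)

lemma orthogonal_transformation_image_grassmannian:
  fixes T :: "'a::euclidean_space \<Rightarrow> 'a"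
  assumes "orthogonal_transformation T" "T ` E = E" "F \<in> grassmannian E m"
  shows "T ` F \<in> grassmannian E m"
proof -
  have "linear T" "inj T" using assms orthogonal_transformation_linear orthogonal_transformation_inj by auto
  then show ?thesis using assms
    by (auto simp: grassmannian_def linear_subspace_image dim_image_eq inj_on_subset)
qed

lemma proj_image:
  fixes T :: "'a::euclidean_space \<Rightarrow> 'a"
  assumes T: "orthogonal_transformation T" and F: "subspace F"
  shows "blinfun_apply (proj (T ` F)) (T x) = T (blinfun_apply (proj F) x)"
proof (rule proj_apply_eqI)
  show "subspace (T ` F)" using linear_subspace_image[OF orthogonal_transformation_linear[OF T] F] .
  show "T (blinfun_apply (proj F) x) \<in> T ` F" using proj_in[OF F] by auto
  fix y assume "y \<in> T ` F"
  then obtain z where z: "z \<in> F" "y = T z" by auto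
  have "T x - T (blinfun_apply (proj F) x) = T (x - blinfun_apply (proj F) x)"
    using linear_diff[OF orthogonal_transformation_linear[OF T]] by metis
  then show "(T x - T (blinfun_apply (proj F) x)) \<bullet> y = 0"
    using T proj_orthogonal[OF F z(1)] z(2) by (simp add: orthogonal_transformation_def)
qed

text \<open>Conjugation by \<open>T\<close> does not increase the operator norm; the same estimate
  for \<open>inv T\<close> gives equality. Thus orthogonal maps carry balls of projections to balls
  of the same radius.\<close>

lemma dist_proj_image:
  fixes T :: "'a::euclidean_space \<Rightarrow> 'a"
  assumes T: "orthogonal_transformation T" and F: "subspace F" and G: "subspace G"
  shows "dist (proj (T ` F)) (proj (T ` G)) = dist (proj F) (proj G)"
proof -
  have le: "dist (proj (T ` F)) (proj (T ` G)) \<le> dist (proj F) (proj G)"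
    if T: "orthogonal_transformation T" and F: "subspace F" and G: "subspace G"
    for T :: "'a \<Rightarrow> 'a" and F G
    unfolding dist_norm
  proof (rule norm_blinfun_bound)
    fix x
    let ?y = "inv T x"
    have "blinfun_apply (proj (T ` F) - proj (T ` G)) x =
        blinfun_apply (proj (T ` F)) (T ?y) - blinfun_apply (proj (T ` G)) (T ?y)"
      by (simp add: blinfun.diff_left orthogonal_transformation_inv_inv[OF T])
    also have "\<dots> = T (blinfun_apply (proj F - proj G) ?y)"
      by (simp add: proj_image[OF T F] proj_image[OF T G] blinfun.diff_left
          linear_diff[OF orthogonal_transformation_linear[OF T]])
    finally have "norm (blinfun_apply (proj (T ` F) - proj (T ` G)) x) =
        norm (blinfun_apply (proj F - proj G) ?y)"
      by (simp add: orthogonal_transformation_norm[OF T])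
    also have "\<dots> \<le> norm (proj F - proj G) * norm ?y" by (rule norm_blinfun)
    also have "norm ?y = norm x"
      by (metis T orthogonal_transformation_inv_inv(1) orthogonal_transformation_norm)
    finally show "norm (blinfun_apply (proj (T ` F) - proj (T ` G)) x) \<le> norm (proj F - proj G) * norm x" .
  qed simp
  have inv: "inv T ` T ` H = H" for H by (simp add: image_image orthogonal_transformation_inv_inv[OF T])
  have sub: "subspace (T ` F)" "subspace (T ` G)"
    using linear_subspace_image[OF orthogonal_transformation_linear[OF T]] F G by blast+
  show ?thesis
    using le[OF T F G] le[OF orthogonal_transformation_inv[OF T] sub]
    unfolding inv by (rule antisym)
qed

lemma subspace_orthogonal_complement_in: "subspace {y \<in> E. \<forall>x\<in>F. orthogonal x y}" if "subspace E"
  using that by (simp add: subspace_def orthogonal_def inner_add_right)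

text \<open>Transitivity on the Grassmannian. \<open>T\<close> glues an isometry from
  \<open>F\<close> to \<open>G\<close>, an isometry between their orthogonal complements inside
  \<open>E\<close>, and the identity on the complement of \<open>E\<close>; Pythagoras shows that
  norms are kept.\<close>

lemma orthogonal_transformation_map_subspace:
  fixes E F G :: "'a::euclidean_space set"
  assumes E: "subspace E" and F: "F \<in> grassmannian E m" and G: "G \<in> grassmannian E m"
  obtains T where "orthogonal_transformation T" "T ` E = E" "T ` F = G"
proof -
  note F' = grassmannianD[OF F] and G' = grassmannianD[OF G]
  let ?F = "{y \<in> E. \<forall>x\<in>F. orthogonal x y}" and ?G = "{y \<in> E. \<forall>x\<in>G. orthogonal x y}"
  obtain f where f: "linear f" "f ` F = G" "\<And>x. x \<in> F \<Longrightarrow> norm (f x) = norm x"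
    by (rule isometries_subspaces[OF F'(1) G'(1)]) (use F' G' in auto)
  have "dim ?F + dim F = dim E" "dim ?G + dim G = dim E"
    using dim_subspace_orthogonal_to_vectors[OF F'(1) E F'(2)] dim_subspace_orthogonal_to_vectors[OF G'(1) E G'(2)]
    by simp_all
  then have "dim ?F = dim ?G" using F' G' by simp
  then obtain g where g: "linear g" "g ` ?F = ?G" "\<And>x. x \<in> ?F \<Longrightarrow> norm (g x) = norm x"
    by (rule isometries_subspaces[OF subspace_orthogonal_complement_in[OF E, of F]
          subspace_orthogonal_complement_in[OF E, of G]]) auto
  let ?PF = "blinfun_apply (proj F)" and ?PE = "blinfun_apply (proj E)"
  define T where "T x = f (?PF x) + g (?PE x - ?PF x) + (x - ?PE x)" for x
  have PF_E: "?PE x - ?PF x \<in> ?F" for x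
  proof -
    have "?PE x - ?PF x \<in> E"
      using proj_in[OF E] proj_in[OF F'(1)] F'(2) E by (auto intro: subspace_diff)
    moreover have "orthogonal y (?PE x - ?PF x)" if "y \<in> F" for y
      using proj_orthogonal[OF F'(1) that, of x] proj_orthogonal[OF E, of y x] F'(2) that
      by (auto simp: orthogonal_def inner_commute inner_diff_left inner_diff_right)
    ultimately show ?thesis by auto
  qed
  have f_in: "f (?PF x) \<in> G" for x using f(2) proj_in[OF F'(1)] by auto
  have g_in: "g (?PE x - ?PF x) \<in> ?G" for x using g(2) PF_E by blast
  have lin: "linear T"
    unfolding T_def
    by (intro linear_compose_add linear_compose_sub linear_compose[OF _ f(1), unfolded o_def]
        linear_compose[OF _ g(1), unfolded o_def] linear_ident)
      (auto simp: linear_conv_bounded_linear blinfun.bounded_linear_right)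
  have nrm: "norm (T x) = norm x" for x
  proof -
    let ?a = "f (?PF x)" and ?b = "g (?PE x - ?PF x)" and ?c = "x - ?PE x"
    have "?a + ?b \<in> E" using f_in[of x] g_in[of x] G'(2) E by (auto intro: subspace_add)
    then have o1: "orthogonal (?a + ?b) ?c"
      using proj_orthogonal[OF E, of "?a + ?b" x] by (simp add: orthogonal_def inner_commute)
    have o2: "orthogonal ?a ?b" using f_in[of x] g_in[of x] by auto
    have o3: "orthogonal (?PF x) (?PE x - ?PF x)" using PF_E[of x] proj_in[OF F'(1), of x] by auto
    have "orthogonal (?PE x) ?c"
      using proj_orthogonal[OF E proj_in[OF E, of x], of x] by (simp add: orthogonal_def inner_commute)
    then have o4: "orthogonal (?PF x + (?PE x - ?PF x)) ?c" by simp
    have "(norm (T x))\<^sup>2 = (norm ?a)\<^sup>2 + (norm ?b)\<^sup>2 + (norm ?c)\<^sup>2"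
      unfolding T_def using norm_add_Pythagorean[OF o1] norm_add_Pythagorean[OF o2] by simp
    also have "\<dots> = (norm (?PF x))\<^sup>2 + (norm (?PE x - ?PF x))\<^sup>2 + (norm ?c)\<^sup>2"
      using f(3)[OF proj_in[OF F'(1), of x]] g(3)[OF PF_E[of x]] by simp
    also have "\<dots> = (norm x)\<^sup>2"
      using norm_add_Pythagorean[OF o3] norm_add_Pythagorean[OF o4] by simp
    finally show ?thesis by simp
  qed
  have T: "orthogonal_transformation T" using lin nrm by (simp add: orthogonal_transformation)
  have "T x = f x" if "x \<in> F" for x
  proof -
    have "?PF x = x" "?PE x = x" using that F' proj_id_iff E by blast+
    then show ?thesis by (simp add: T_def linear_0[OF g(1)])
  qed
  then have TF: "T ` F = G" using f(2) by auto
  have "T x \<in> E" if "x \<in> E" for x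
  proof -
    have "?PE x = x" using that proj_id_iff E by blast
    then show ?thesis
      using f_in[of x] g_in[of x] G'(2) E by (auto simp: T_def intro!: subspace_add)
  qed
  then have "T ` E \<subseteq> E" by auto
  moreover have "dim (T ` E) = dim E"
    using orthogonal_transformation_inj[OF T] lin by (intro dim_image_eq) (auto simp: inj_on_def)
  ultimately have "T ` E = E"
    using E lin by (intro subspace_dim_equal) (auto intro: linear_subspace_image)
  with T TF show ?thesis using that by blast
qed

text \<open>The witness is the reflection in the hyperplane orthogonal to \<open>u - v\<close>. It
  preserves \<open>E\<close> because that vector lies in \<open>E\<close>, and it is the identity
  when \<open>u = v\<close>.\<close>

lemma orthogonal_transformation_map_unit_vector:
  fixes E :: "'a::euclidean_space set"
  assumes E: "subspace E" and u: "u \<in> E \<inter> sphere 0 1" and v: "v \<in> E \<inter> sphere 0 1"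
  obtains T where "orthogonal_transformation T" "T ` E = E" "T u = v"
proof -
  define w where "w = u - v"
  define T where "T x = x - (2 * (x \<bullet> w) / (w \<bullet> w)) *\<^sub>R w" for x
  have w: "w \<in> E" using u v E by (auto simp: w_def intro: subspace_diff)
  have uv: "u \<bullet> u = 1" "v \<bullet> v = 1" using u v by (auto simp: norm_eq_1)
  have lin: "linear T"
    by (rule linearI) (auto simp: T_def inner_add_left algebra_simps add_divide_distrib)
  have nrm: "norm (T x) = norm x" for x
  proof (cases "w = 0")
    case False
    have "T x \<bullet> T x = x \<bullet> x"
      using False by (simp add: T_def inner_diff_left inner_diff_right inner_commute field_simps)
    then show ?thesis by (simp add: norm_eq_sqrt_inner)
  qed (simp add: T_def)
  have T: "orthogonal_transformation T" using lin nrm by (simp add: orthogonal_transformation)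
  have "T u = v"
  proof (cases "w = 0")
    case False
    have "2 * (u \<bullet> w) = w \<bullet> w"
      using uv by (simp add: w_def inner_diff_left inner_diff_right inner_commute)
    then show ?thesis using False by (simp add: T_def) (simp add: w_def)
  qed (auto simp: T_def w_def)
  moreover have "T ` E \<subseteq> E" using w E by (auto simp: T_def intro: subspace_diff subspace_scale)
  moreover have "dim (T ` E) = dim E"
    using orthogonal_transformation_inj[OF T] lin by (intro dim_image_eq) (auto simp: inj_on_def)
  then have "T ` E = E"
    using \<open>T ` E \<subseteq> E\<close> E lin by (intro subspace_dim_equal) (auto intro: linear_subspace_image)
  ultimately show ?thesis using T that by blast
qed

section \<open>Lebesgue measure on a subspace\<close>

lemma unit_ball_vol_nonzero [simp]: "unit_ball_vol (real n) \<noteq> 0"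
  using unit_ball_vol_pos[of "real n"] by linarith

lemma subspace_lborel_orthonormal_basis:
  fixes F :: "'a::euclidean_space set"
  assumes F: "subspace F"
  obtains B where "finite B" "card B = dim F" "pairwise orthogonal B" "\<And>b. b \<in> B \<Longrightarrow> norm b = 1"
    "span B = F" "subspace_lborel F = distr (\<Pi>\<^sub>M b\<in>B. lborel) borel (\<lambda>x. \<Sum>b\<in>B. x b *\<^sub>R b)"
proof -
  let ?P = "\<lambda>B. pairwise orthogonal B \<and> (\<forall>b\<in>B. norm b = 1) \<and> span B = F"
  define B where "B = (SOME B. ?P B)"
  have "\<exists>B. ?P B" using orthonormal_basis_subspace[OF F] by metis
  then have B: "?P B" unfolding B_def by (rule someI_ex)
  moreover have "0 \<notin> B" using B by force
  ultimately have indep: "independent B" using pairwise_orthogonal_independent by blast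
  have "finite B" by (rule independent_imp_finite[OF indep])
  moreover have "card B = dim F" using B dim_span_eq_card_independent[OF indep] by simp
  moreover have "subspace_lborel F = distr (\<Pi>\<^sub>M b\<in>B. lborel) borel (\<lambda>x. \<Sum>b\<in>B. x b *\<^sub>R b)"
    unfolding subspace_lborel_def B_def Let_def ..
  ultimately show ?thesis using B that by blast
qed

lemma sets_subspace_lborel [simp, measurable_cong]: "sets (subspace_lborel F) = sets borel"
  by (simp add: subspace_lborel_def Let_def)

lemma space_subspace_lborel [simp]: "space (subspace_lborel F) = UNIV"
  by (simp add: subspace_lborel_def Let_def)

text \<open>Used to move a ball centred anywhere in the subspace to the origin of the coordinate
  space, where its volume is known.\<close>

lemma PiM_lborel_translate:
  fixes c :: "'i \<Rightarrow> real"
  assumes I: "finite I"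
  shows "distr (\<Pi>\<^sub>M i\<in>I. lborel) (\<Pi>\<^sub>M i\<in>I. lborel) (\<lambda>x. \<lambda>i\<in>I. c i + x i) = (\<Pi>\<^sub>M i\<in>I. lborel)"
proof -
  interpret product_sigma_finite "\<lambda>_::'i. lborel :: real measure" ..
  show ?thesis
  proof (rule PiM_eqI[OF I])
    fix A :: "'i \<Rightarrow> real set" assume A: "\<And>i. i \<in> I \<Longrightarrow> A i \<in> sets lborel"
    have m: "(\<lambda>t. c i + t) -` A i \<in> sets borel" if "i \<in> I" for i
      using A[OF that] measurable_sets[of "\<lambda>t. c i + t" borel borel "A i"] by simp
    have "emeasure (distr (\<Pi>\<^sub>M i\<in>I. lborel) (\<Pi>\<^sub>M i\<in>I. lborel) (\<lambda>x. \<lambda>i\<in>I. c i + x i)) (Pi\<^sub>E I A) =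
        emeasure (\<Pi>\<^sub>M i\<in>I. lborel)
          ((\<lambda>x. \<lambda>i\<in>I. c i + x i) -` Pi\<^sub>E I A \<inter> space (\<Pi>\<^sub>M i\<in>I. (lborel :: real measure)))"
      using A I by (intro emeasure_distr sets_PiM_I_finite) auto
    also have "(\<lambda>x. \<lambda>i\<in>I. c i + x i) -` Pi\<^sub>E I A \<inter> space (\<Pi>\<^sub>M i\<in>I. (lborel :: real measure)) =
        Pi\<^sub>E I (\<lambda>i. (\<lambda>t. c i + t) -` A i)"
      by (auto simp: space_PiM PiE_iff)
    also have "emeasure (\<Pi>\<^sub>M i\<in>I. lborel) \<dots> = (\<Prod>i\<in>I. emeasure lborel ((\<lambda>t. c i + t) -` A i))"
      using m I by (intro emeasure_PiM) auto
    also have "\<dots> = (\<Prod>i\<in>I. emeasure lborel (A i))"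
    proof (intro prod.cong refl)
      fix i assume i: "i \<in> I"
      have "emeasure lborel (A i) = emeasure (distr lborel borel ((+) (c i))) (A i)"
        by (simp add: lborel_distr_plus)
      also have "\<dots> = emeasure lborel ((\<lambda>t. c i + t) -` A i)"
        using A[OF i] by (subst emeasure_distr) auto
      finally show "emeasure lborel ((\<lambda>t. c i + t) -` A i) = emeasure lborel (A i)" by simp
    qed
    finally show "emeasure (distr (\<Pi>\<^sub>M i\<in>I. lborel) (\<Pi>\<^sub>M i\<in>I. lborel) (\<lambda>x. \<lambda>i\<in>I. c i + x i)) (Pi\<^sub>E I A) =
        (\<Prod>i\<in>I. emeasure lborel (A i))" .
  qed simp
qed

text \<open>Coordinates in an orthonormal basis are an isometry. The value does not involve the
  basis that was chosen, so together with the uniqueness theorem it removes all dependence on that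
  choice.\<close>

lemma emeasure_subspace_lborel_cball:
  fixes F :: "'a::euclidean_space set"
  assumes F: "subspace F" and x: "x \<in> F" and r: "0 < r"
  shows "emeasure (subspace_lborel F) (cball x r) = ennreal (unit_ball_vol (dim F) * r ^ dim F)"
proof -
  obtain B where B: "finite B" "card B = dim F" "pairwise orthogonal B" "\<And>b. b \<in> B \<Longrightarrow> norm b = 1"
    "span B = F" "subspace_lborel F = distr (\<Pi>\<^sub>M b\<in>B. lborel) borel (\<lambda>x. \<Sum>b\<in>B. x b *\<^sub>R b)"
    using subspace_lborel_orthonormal_basis[OF F] by blast
  let ?P = "\<Pi>\<^sub>M b\<in>B. (lborel :: real measure)"
  obtain c where c: "x = (\<Sum>b\<in>B. c b *\<^sub>R b)"
    using x B(1,5) by (auto simp: span_finite)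
  have norm: "norm (\<Sum>b\<in>B. y b *\<^sub>R b) = sqrt (\<Sum>b\<in>B. (y b)\<^sup>2)" for y
  proof -
    have "(norm (\<Sum>b\<in>B. y b *\<^sub>R b))\<^sup>2 = (\<Sum>b\<in>B. (norm (y b *\<^sub>R b))\<^sup>2)"
      by (intro norm_sum_Pythagorean B(1) pairwise_ortho_scaleR)
        (use B(3) in \<open>simp add: pairwise_def\<close>)
    also have "\<dots> = (\<Sum>b\<in>B. (y b)\<^sup>2)" using B(4) by (intro sum.cong) auto
    finally show ?thesis by (metis norm_ge_zero real_sqrt_unique)
  qed
  let ?S = "{f. sqrt (\<Sum>b\<in>B. (f b)\<^sup>2) \<le> r} \<inter> space ?P"
  let ?S' = "{f. sqrt (\<Sum>b\<in>B. (f b - c b)\<^sup>2) \<le> r} \<inter> space ?P"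
  have S': "(\<lambda>y. \<Sum>b\<in>B. y b *\<^sub>R b) -` cball x r \<inter> space ?P = ?S'"
  proof -
    have "dist x (\<Sum>b\<in>B. y b *\<^sub>R b) = sqrt (\<Sum>b\<in>B. (y b - c b)\<^sup>2)" for y
      using norm[of "\<lambda>b. y b - c b"]
      by (simp add: c dist_norm norm_minus_commute algebra_simps sum_subtractf)
    then show ?thesis by auto
  qed
  have m: "?S' \<in> sets ?P" using B(1) by measurable
  have "emeasure (subspace_lborel F) (cball x r) = emeasure ?P ?S'"
    unfolding B(6) by (subst emeasure_distr) (auto simp: S')
  also have "\<dots> = emeasure (distr ?P ?P (\<lambda>y. \<lambda>b\<in>B. c b + y b)) ?S'"
    by (simp add: PiM_lborel_translate[OF B(1)])
  also have "\<dots> = emeasure ?P ((\<lambda>y. \<lambda>b\<in>B. c b + y b) -` ?S' \<inter> space ?P)"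
    using m by (intro emeasure_distr) measurable
  also have "(\<lambda>y. \<lambda>b\<in>B. c b + y b) -` ?S' \<inter> space ?P = ?S"
    by (auto simp: space_PiM)
  also have "emeasure ?P ?S = ennreal (unit_ball_vol (real (card B)) * r ^ card B)"
    by (rule emeasure_cball_aux[OF B(1) r])
  finally show ?thesis by (simp add: B(2))
qed

lemma AE_subspace_lborel:
  fixes F :: "'a::euclidean_space set"
  assumes F: "subspace F"
  shows "AE x in subspace_lborel F. x \<in> F"
proof -
  obtain B where B: "finite B" "span B = F"
    "subspace_lborel F = distr (\<Pi>\<^sub>M b\<in>B. lborel) borel (\<lambda>x. \<Sum>b\<in>B. x b *\<^sub>R b)"
    using subspace_lborel_orthonormal_basis[OF F] by blast
  have "(\<Sum>b\<in>B. x b *\<^sub>R b) \<in> F" for x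
    unfolding B(2)[symmetric] by (intro span_sum span_scale span_base)
  moreover have "closed F" by (rule closed_subspace[OF F])
  ultimately show ?thesis
    unfolding B(3) by (subst AE_distr_iff) auto
qed

lemma sigma_finite_subspace_lborel:
  fixes F :: "'a::euclidean_space set"
  assumes "subspace F"
  shows "sigma_finite_measure (subspace_lborel F)"
  by (rule sigma_finite_measure_cballs[of _ 0])
    (simp_all add: emeasure_subspace_lborel_cball[OF assms subspace_0[OF assms]])

text \<open>The working characterisation of volume in \<open>F\<close>: rotations, dilations and the
  case of the whole space are all checked on balls only.\<close>

lemma subspace_lborel_eqI:
  fixes F :: "'a::euclidean_space set"
  assumes F: "subspace F" and "sets M = sets borel" "AE x in M. x \<in> F"
    and "\<And>x r. x \<in> F \<Longrightarrow> 0 < r \<Longrightarrow> emeasure M (cball x r) = ennreal (unit_ball_vol (dim F) * r ^ dim F)"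
  shows "M = subspace_lborel F"
  by (rule uniformly_distributed_measure_eqI[where X = F and ?x0.0 = 0
        and a = "\<lambda>r. ennreal (unit_ball_vol (dim F) * r ^ dim F)"])
    (use assms in \<open>auto simp: AE_subspace_lborel emeasure_subspace_lborel_cball subspace_0\<close>)

lemma distr_subspace_lborel:
  fixes T :: "'a::euclidean_space \<Rightarrow> 'a"
  assumes T: "orthogonal_transformation T" and F: "subspace F"
  shows "distr (subspace_lborel F) borel T = subspace_lborel (T ` F)"
proof (rule subspace_lborel_eqI)
  note [measurable] = borel_measurable_orthogonal_transformation[OF T]
  show F': "subspace (T ` F)" using linear_subspace_image[OF orthogonal_transformation_linear[OF T] F] .
  have "closed (T ` F)" by (rule closed_subspace[OF F'])
  then show "AE x in distr (subspace_lborel F) borel T. x \<in> T ` F"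
    using AE_subspace_lborel[OF F] by (subst AE_distr_iff) (auto elim: eventually_mono)
  fix x r assume "x \<in> T ` F" "0 < (r::real)"
  then obtain y where y: "y \<in> F" "x = T y" by auto
  have "dim (T ` F) = dim F"
    using orthogonal_transformation_inj[OF T] orthogonal_transformation_linear[OF T]
    by (intro dim_image_eq) (auto simp: inj_on_def)
  then show "emeasure (distr (subspace_lborel F) borel T) (cball x r) =
      ennreal (unit_ball_vol (dim (T ` F)) * r ^ dim (T ` F))"
    using emeasure_subspace_lborel_cball[OF F y(1) \<open>0 < r\<close>]
    by (simp add: emeasure_distr y orthogonal_transformation_vimage_cball[OF T])
qed simp

text \<open>The image under dilation by \<open>c\<close>, multiplied by \<open>c ^ dim F\<close>,
  gives every ball centred in \<open>F\<close> its right volume.\<close>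

lemma emeasure_subspace_lborel_scale:
  fixes F :: "'a::euclidean_space set"
  assumes F: "subspace F" and c: "0 < c" and A: "A \<in> sets borel"
  shows "emeasure (subspace_lborel F) A =
    ennreal (c ^ dim F) * emeasure (subspace_lborel F) ((\<lambda>x. c *\<^sub>R x) -` A)"
proof -
  let ?M = "density (distr (subspace_lborel F) borel (\<lambda>x. c *\<^sub>R x)) (\<lambda>_. ennreal (c ^ dim F))"
  have "?M = subspace_lborel F"
  proof (rule subspace_lborel_eqI[OF F])
    have "closed F" by (rule closed_subspace[OF F])
    have "AE x in distr (subspace_lborel F) borel (\<lambda>x. c *\<^sub>R x). x \<in> F"
      using AE_subspace_lborel[OF F] \<open>closed F\<close> F
      by (subst AE_distr_iff) (auto elim: eventually_mono simp: subspace_scale)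
    then show "AE x in ?M. x \<in> F"
      by (auto simp: AE_density elim: eventually_mono)
    fix x r assume x: "x \<in> F" "0 < (r::real)"
    have "(\<lambda>x. c *\<^sub>R x) -` cball x r = cball (x /\<^sub>R c) (r / c)"
    proof (intro set_eqI)
      fix y
      have "x - c *\<^sub>R y = c *\<^sub>R (x /\<^sub>R c - y)" using c by (simp add: algebra_simps)
      then have "dist x (c *\<^sub>R y) = c * dist (x /\<^sub>R c) y" using c by (simp add: dist_norm)
      then show "y \<in> (\<lambda>x. c *\<^sub>R x) -` cball x r \<longleftrightarrow> y \<in> cball (x /\<^sub>R c) (r / c)"
        using c by (simp add: field_simps)
    qed
    moreover have "x /\<^sub>R c \<in> F" using x F by (simp add: subspace_scale)
    ultimately have "emeasure ?M (cball x r) =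
        ennreal (c ^ dim F) * ennreal (unit_ball_vol (dim F) * (r / c) ^ dim F)"
      using c x F by (simp add: emeasure_density_const emeasure_distr emeasure_subspace_lborel_cball)
    also have "\<dots> = ennreal (unit_ball_vol (dim F) * r ^ dim F)"
      using c x(2) by (simp add: ennreal_mult[symmetric] power_divide)
    finally show "emeasure ?M (cball x r) = ennreal (unit_ball_vol (dim F) * r ^ dim F)" .
  qed simp
  then have "emeasure (subspace_lborel F) A = emeasure ?M A" by simp
  also have "\<dots> = ennreal (c ^ dim F) * emeasure (subspace_lborel F) ((\<lambda>x. c *\<^sub>R x) -` A)"
    using A by (simp add: emeasure_density_const emeasure_distr)
  finally show ?thesis .
qed

lemma subspace_lborel_UNIV: "subspace_lborel (UNIV :: 'a::euclidean_space set) = lborel"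
  by (rule subspace_lborel_eqI[symmetric]) (auto simp: emeasure_cball)

text \<open>The origin lies in balls of arbitrarily small volume. In dimension 0 the measure is the
  unit mass at the origin, whence the positivity assumption.\<close>

lemma AE_subspace_lborel_nonzero:
  fixes F :: "'a::euclidean_space set"
  assumes F: "subspace F" and d: "0 < dim F"
  shows "AE x in subspace_lborel F. x \<noteq> 0"
proof -
  have "emeasure (subspace_lborel F) {0} = 0"
  proof -
    have le: "emeasure (subspace_lborel F) {0} \<le> ennreal (unit_ball_vol (dim F) * (1 / real (Suc n)) ^ dim F)" for n
      using emeasure_subspace_lborel_cball[OF F subspace_0[OF F], of "1 / real (Suc n)", symmetric]
      by (auto intro!: emeasure_mono)
    have "(\<lambda>n. ennreal (unit_ball_vol (dim F) * (1 / real (Suc n)) ^ dim F)) \<longlonglongrightarrow>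
        ennreal (unit_ball_vol (dim F) * 0 ^ dim F)"
      by (intro tendsto_intros tendsto_ennrealI LIMSEQ_inverse_real_of_nat[unfolded inverse_eq_divide])
    then have "emeasure (subspace_lborel F) {0} \<le> ennreal (unit_ball_vol (dim F) * 0 ^ dim F)"
      by (rule LIMSEQ_le_const) (use le in blast)
    moreover have "0 ^ dim F = (0 :: real)" using d by (rule zero_power)
    ultimately show ?thesis by simp
  qed
  then show ?thesis by (intro AE_I[of _ _ "{0}"]) auto
qed

text \<open>The common source of randomness: sphere laws and random subspaces are images of this one
  rotation-invariant probability measure.\<close>

definition ball_measure :: "'a::euclidean_space measure" where
  "ball_measure = uniform_measure lborel (cball 0 1)"

lemma sets_ball_measure [simp, measurable_cong]: "sets ball_measure = sets borel"
  by (simp add: ball_measure_def)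

lemma space_ball_measure [simp]: "space ball_measure = UNIV"
  by (simp add: ball_measure_def)

lemma prob_space_ball_measure: "prob_space (ball_measure :: 'a::euclidean_space measure)"
  unfolding ball_measure_def
  by (rule prob_space_uniform_measure) (simp_all add: emeasure_cball)

lemma distr_lborel_orthogonal_transformation:
  fixes T :: "'a::euclidean_space \<Rightarrow> 'a"
  assumes "orthogonal_transformation T"
  shows "distr lborel borel T = lborel"
  using distr_subspace_lborel[OF assms subspace_UNIV] orthogonal_transformation_surj[OF assms]
  by (simp add: subspace_lborel_UNIV)

lemma distr_ball_measure:
  fixes T :: "'a::euclidean_space \<Rightarrow> 'a"
  assumes T: "orthogonal_transformation T"
  shows "distr ball_measure borel T = ball_measure"
proof (rule measure_eqI)
  note [measurable] = borel_measurable_orthogonal_transformation[OF T]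
  fix A assume "A \<in> sets (distr ball_measure borel T)"
  then have A: "A \<in> sets borel" by simp
  have TA: "T -` A \<in> sets borel" using A measurable_sets[of T borel borel A] by simp
  have "cball 0 1 \<inter> T -` A = T -` (cball 0 1 \<inter> A)"
    using orthogonal_transformation_norm[OF T] by auto
  moreover have "emeasure lborel (T -` (cball 0 1 \<inter> A)) = emeasure (distr lborel borel T) (cball 0 1 \<inter> A)"
    using A by (subst emeasure_distr) auto
  ultimately show "emeasure (distr ball_measure borel T) A = emeasure ball_measure A"
    using A TA by (simp add: emeasure_distr ball_measure_def distr_lborel_orthogonal_transformation[OF T])
qed simp

lemma AE_ball_measure_not_in_subspace:
  fixes S :: "'a::euclidean_space set"
  assumes S: "subspace S" "S \<noteq> UNIV"
  shows "AE x in ball_measure. x \<notin> S"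
proof -
  have "dim S < DIM('a)"
    using S dim_eq_full[of S] dim_subset_UNIV[of S] span_eq_iff[THEN iffD2, OF S(1)] by auto
  then have "S \<in> null_sets lebesgue"
    using negligible_lowdim negligible_iff_null_sets by blast
  moreover have "S \<in> sets lborel" using closed_subspace[OF S(1)] by simp
  ultimately have "S \<in> null_sets lborel" by (simp add: null_sets_completion_iff)
  then have "AE x in lborel. x \<notin> S" by (rule AE_not_in)
  then show ?thesis
    unfolding ball_measure_def by (intro AE_uniform_measureI) auto
qed

text \<open>The points where both projections agree form a linear subspace, proper because it misses
  every vector of \<open>E\<close> outside \<open>F\<close>, hence null. This keeps each
  Gram-Schmidt step from degenerating.\<close>

lemma AE_ball_measure_proj_neq:
  fixes E F :: "'a::euclidean_space set"
  assumes E: "subspace E" and F: "subspace F" "F \<subseteq> E" "dim F < dim E"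
  shows "AE x in ball_measure. blinfun_apply (proj E) x \<noteq> blinfun_apply (proj F) x"
proof -
  let ?S = "{x. blinfun_apply (proj E) x = blinfun_apply (proj F) x}"
  have "subspace ?S" by (simp add: subspace_def blinfun.add_right blinfun.scaleR_right)
  moreover have "?S \<noteq> UNIV"
  proof -
    have "F \<noteq> E" using F by auto
    then obtain y where "y \<in> E" "y \<notin> F" using F by auto
    then have "blinfun_apply (proj E) y = y" "blinfun_apply (proj F) y \<noteq> y"
      using proj_id_iff E F by blast+
    then have "y \<notin> ?S" by simp
    then show ?thesis by blast
  qed
  ultimately show ?thesis using AE_ball_measure_not_in_subspace[of ?S] by simp
qed

lemma AE_ball_measure_proj_nonzero:
  fixes F :: "'a::euclidean_space set"
  assumes F: "subspace F" "0 < dim F"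
  shows "AE x in ball_measure. blinfun_apply (proj F) x \<noteq> 0"
proof -
  have "blinfun_apply (proj {0 :: 'a}) x = 0" for x :: 'a
    using proj_in[of "{0 :: 'a}" x] by simp
  then show ?thesis
    using AE_ball_measure_proj_neq[OF F(1), of "{0}"] F subspace_0[OF F(1)] by simp
qed

section \<open>The Haar measure on the Grassmannian\<close>

lemma space_grassmannian_borel [simp]: "space (grassmannian_borel E m) = grassmannian E m"
  unfolding grassmannian_borel_def
  by (rule space_measure_of) (auto simp: grassmannian_topology_def openin_pullback_topology)

text \<open>Reduces measurability questions on the Grassmannian to questions about operator-valued
  maps.\<close>

lemma sets_grassmannian_borel_vimage:
  "sets (grassmannian_borel E m) = sets (vimage_algebra (grassmannian E m) proj borel)"
proof -
  have "vimage_algebra (grassmannian E m) proj borel =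
      sigma (grassmannian E m) {proj -` U \<inter> grassmannian E m | U. U \<in> {S. open S}}"
    unfolding borel_def by (rule vimage_algebra_sigma) auto
  moreover have "{U. openin (grassmannian_topology E m) U} =
      {proj -` U \<inter> grassmannian E m | U. U \<in> {S. open S}}"
    by (auto simp: grassmannian_topology_def openin_pullback_topology proj_def[abs_def])
  ultimately show ?thesis by (simp add: grassmannian_borel_def)
qed

lemma sets_grassmannian_borel:
  "sets (grassmannian_borel E m) = {proj -` A \<inter> grassmannian E m | A. A \<in> sets borel}"
  unfolding sets_grassmannian_borel_vimage by (rule sets_vimage_algebra2) auto

lemma measurable_proj:
  assumes "sets M = sets (grassmannian_borel E m)"
  shows "proj \<in> borel_measurable M"
proof -
  have "proj \<in> vimage_algebra (grassmannian E m) proj borel \<rightarrow>\<^sub>M borel"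
    by (rule measurable_vimage_algebra1) auto
  then show ?thesis
    by (subst measurable_cong_sets[OF assms refl],
        subst measurable_cong_sets[OF sets_grassmannian_borel_vimage refl])
qed

lemma measurable_into_grassmannian:
  assumes N: "sets N = sets (grassmannian_borel E m)"
    and g: "\<And>x. x \<in> space M \<Longrightarrow> g x \<in> grassmannian E m" "(\<lambda>x. proj (g x)) \<in> borel_measurable M"
  shows "g \<in> M \<rightarrow>\<^sub>M N"
proof -
  have "g \<in> M \<rightarrow>\<^sub>M vimage_algebra (grassmannian E m) proj borel"
    using g by (intro measurable_vimage_algebra2) auto
  then show ?thesis
    by (subst measurable_cong_sets[OF refl N],
        subst measurable_cong_sets[OF refl sets_grassmannian_borel_vimage])
qed

text \<open>The action of \<open>T\<close> on subspaces, transported to projections and extended to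
  all operators, where it is continuous and hence Borel.\<close>

definition conj_blinfun :: "('a::euclidean_space \<Rightarrow> 'a) \<Rightarrow> ('a \<Rightarrow>\<^sub>L 'a) \<Rightarrow> 'a \<Rightarrow>\<^sub>L 'a" where
  "conj_blinfun T P = Blinfun T o\<^sub>L P o\<^sub>L Blinfun (inv T)"

lemma conj_blinfun_apply:
  assumes "orthogonal_transformation T"
  shows "blinfun_apply (conj_blinfun T P) x = T (blinfun_apply P (inv T x))"
  using orthogonal_transformation_bounded_linear[OF assms]
    orthogonal_transformation_bounded_linear[OF orthogonal_transformation_inv[OF assms]]
  by (simp add: conj_blinfun_def bounded_linear_Blinfun_apply)

lemma borel_measurable_conj_blinfun [measurable]: "conj_blinfun T \<in> borel_measurable borel"
  unfolding conj_blinfun_def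
  by (intro borel_measurable_continuous_onI continuous_intros)

lemma proj_image_eq:
  assumes T: "orthogonal_transformation T" and F: "subspace F"
  shows "proj (T ` F) = conj_blinfun T (proj F)"
proof (rule blinfun_eqI)
  fix x
  show "blinfun_apply (proj (T ` F)) x = blinfun_apply (conj_blinfun T (proj F)) x"
    using proj_image[OF T F, of "inv T x"]
    by (simp add: conj_blinfun_apply[OF T] orthogonal_transformation_inv_inv[OF T])
qed

lemma measurable_image_grassmannian:
  assumes T: "orthogonal_transformation T" "T ` E = E"
    and N: "sets N = sets (grassmannian_borel E m)"
  shows "(\<lambda>F. T ` F) \<in> N \<rightarrow>\<^sub>M N"
proof (rule measurable_into_grassmannian[OF N])
  have sp: "space N = grassmannian E m" using sets_eq_imp_space_eq[OF N] by simp
  show "T ` F \<in> grassmannian E m" if "F \<in> space N" for F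
    using that orthogonal_transformation_image_grassmannian[OF T] sp by simp
  have "(\<lambda>F. proj (T ` F)) \<in> borel_measurable N \<longleftrightarrow> (\<lambda>F. conj_blinfun T (proj F)) \<in> borel_measurable N"
    by (intro measurable_cong) (auto simp: sp proj_image_eq[OF T(1)] grassmannianD)
  then show "(\<lambda>F. proj (T ` F)) \<in> borel_measurable N"
    using measurable_compose[OF measurable_proj[OF N] borel_measurable_conj_blinfun] by simp
qed

section \<open>Uniqueness of the Haar measure\<close>

definition haar_on_grassmannian :: "'a::euclidean_space set \<Rightarrow> nat \<Rightarrow> 'a set measure \<Rightarrow> bool" where
  "haar_on_grassmannian E m \<nu> \<longleftrightarrow> prob_space \<nu> \<and> sets \<nu> = sets (grassmannian_borel E m) \<and>
     (\<forall>T. orthogonal_transformation T \<and> T ` E = E \<longrightarrow> distr \<nu> \<nu> (\<lambda>F. T ` F) = \<nu>)"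

text \<open>Push both measures forward to projections. Invariance, transitivity and the isometric
  action give balls of equal radius equal measure, so the images agree; every measurable set of
  subspaces is a preimage under \<open>proj\<close>, so the measures agree too.\<close>

lemma haar_on_grassmannian_unique:
  fixes E :: "'a::euclidean_space set"
  assumes E: "subspace E" and "haar_on_grassmannian E m \<nu>1" "haar_on_grassmannian E m \<nu>2"
  shows "\<nu>1 = \<nu>2"
proof -
  let ?X = "proj ` grassmannian E m"
  have inv: "emeasure (distr \<nu> borel proj) (cball x r) = emeasure (distr \<nu> borel proj) (cball y r)"
    and one: "emeasure (distr \<nu> borel proj) UNIV = 1"
    and AE: "AE P in distr \<nu> borel proj. P \<in> ?X"
    if \<nu>: "haar_on_grassmannian E m \<nu>" and xy: "x \<in> ?X" "y \<in> ?X" for \<nu> x y r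
  proof -
    interpret prob_space \<nu> using \<nu> by (simp add: haar_on_grassmannian_def)
    have sets: "sets \<nu> = sets (grassmannian_borel E m)" using \<nu> by (simp add: haar_on_grassmannian_def)
    have sp: "space \<nu> = grassmannian E m" using sets_eq_imp_space_eq[OF sets] by simp
    note [measurable] = measurable_proj[OF sets]
    obtain F G where FG: "F \<in> grassmannian E m" "x = proj F" "G \<in> grassmannian E m" "y = proj G"
      using xy by auto
    obtain T where T: "orthogonal_transformation T" "T ` E = E" "T ` F = G"
      by (rule orthogonal_transformation_map_subspace[OF E FG(1,3)])
    note [measurable] = measurable_image_grassmannian[OF T(1,2) sets]
    have m: "proj -` cball y r \<inter> space \<nu> \<in> sets \<nu>" by measurable
    have "emeasure (distr \<nu> borel proj) (cball y r) = emeasure \<nu> (proj -` cball y r \<inter> space \<nu>)"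
      by (rule emeasure_distr) auto
    also have "\<dots> = emeasure (distr \<nu> \<nu> (\<lambda>F. T ` F)) (proj -` cball y r \<inter> space \<nu>)"
      using \<nu> T by (simp add: haar_on_grassmannian_def)
    also have "\<dots> = emeasure \<nu> ((\<lambda>F. T ` F) -` (proj -` cball y r \<inter> space \<nu>) \<inter> space \<nu>)"
      by (rule emeasure_distr) (use m in auto)
    also have "(\<lambda>F. T ` F) -` (proj -` cball y r \<inter> space \<nu>) \<inter> space \<nu> = proj -` cball x r \<inter> space \<nu>"
    proof -
      have "dist y (proj (T ` H)) = dist x (proj H)" if "H \<in> grassmannian E m" for H
        using dist_proj_image[OF T(1) grassmannianD(1)[OF FG(1)] grassmannianD(1)[OF that]] FG T by simp
      then show ?thesis
        using orthogonal_transformation_image_grassmannian[OF T(1,2)] by (auto simp: sp)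
    qed
    also have "emeasure \<nu> \<dots> = emeasure (distr \<nu> borel proj) (cball x r)"
      by (rule emeasure_distr[symmetric]) auto
    finally show "emeasure (distr \<nu> borel proj) (cball x r) = emeasure (distr \<nu> borel proj) (cball y r)" ..
    show "emeasure (distr \<nu> borel proj) UNIV = 1"
      by (simp add: emeasure_distr emeasure_space_1)
    have "closed ?X" by (rule compact_imp_closed[OF compact_proj_grassmannian[OF E]])
    then show "AE P in distr \<nu> borel proj. P \<in> ?X"
      by (subst AE_distr_iff) (auto simp: sp)
  qed
  interpret \<nu>1: prob_space \<nu>1 using assms by (simp add: haar_on_grassmannian_def)
  have sets: "sets \<nu>1 = sets (grassmannian_borel E m)" "sets \<nu>2 = sets (grassmannian_borel E m)"
    using assms by (simp_all add: haar_on_grassmannian_def)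
  have sp: "space \<nu>1 = grassmannian E m" using sets_eq_imp_space_eq[OF sets(1)] by simp
  obtain F where "F \<in> grassmannian E m" using \<nu>1.not_empty sp by auto
  then have X: "proj F \<in> ?X" by simp
  have eq: "distr \<nu>1 borel proj = distr \<nu>2 borel proj"
    by (rule uniformly_distributed_finite_measure_eqI[where X = ?X and c = 1,
          OF _ _ one[OF assms(2) X X] one[OF assms(3) X X] _ _ AE[OF assms(2) X X] AE[OF assms(3) X X]
             compact_proj_grassmannian[OF E] inv[OF assms(2)] inv[OF assms(3)]])
      simp_all
  show ?thesis
  proof (rule measure_eqI)
    fix A assume "A \<in> sets \<nu>1"
    then obtain B where B: "B \<in> sets borel" "A = proj -` B \<inter> grassmannian E m"
      by (auto simp: sets sets_grassmannian_borel)
    have sp2: "space \<nu>2 = grassmannian E m" using sets_eq_imp_space_eq[OF sets(2)] by simp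
    show "emeasure \<nu>1 A = emeasure \<nu>2 A"
      using arg_cong[OF eq, of "\<lambda>M. emeasure M B"] B
      by (simp add: emeasure_distr measurable_proj sets sp sp2)
  qed (simp add: sets)
qed

section \<open>Existence of the Haar measure by random Gram-Schmidt\<close>

lemma borel_measurable_sgn_vector [measurable]:
  "(sgn :: 'a::euclidean_space \<Rightarrow> 'a) \<in> borel_measurable borel"
  unfolding sgn_div_norm[abs_def] by measurable

lemma borel_measurable_blinfun_apply [measurable (raw)]:
  fixes f :: "'b \<Rightarrow> 'a::euclidean_space \<Rightarrow>\<^sub>L 'c::euclidean_space"
  assumes "f \<in> borel_measurable M" "g \<in> borel_measurable M"
  shows "(\<lambda>x. blinfun_apply (f x) (g x)) \<in> borel_measurable M"
  by (rule borel_measurable_continuous_Pair[OF assms]) (intro continuous_intros)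

text \<open>For a unit vector \<open>v\<close> this is the orthogonal projection onto its
  line.\<close>

definition outer_blinfun :: "'a::real_inner \<Rightarrow> 'a \<Rightarrow>\<^sub>L 'a" where
  "outer_blinfun v = blinfun_scaleR_left v o\<^sub>L blinfun_inner_right v"

lemma outer_blinfun_apply [simp]: "blinfun_apply (outer_blinfun v) x = (v \<bullet> x) *\<^sub>R v"
  by (simp add: outer_blinfun_def)

lemma borel_measurable_outer_blinfun [measurable]:
  "(outer_blinfun :: 'a::euclidean_space \<Rightarrow> _) \<in> borel_measurable borel"
  unfolding outer_blinfun_def
  by (intro borel_measurable_continuous_onI continuous_intros)

text \<open>One Gram-Schmidt step, written on operators so that it is a Borel map: the part of
  \<open>x\<close> in \<open>E\<close> not captured by \<open>P\<close> is normalised and its line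
  is added. In the degenerate case \<open>sgn 0 = 0\<close> leaves \<open>P\<close>
  unchanged.\<close>

definition extend_proj :: "'a::euclidean_space set \<Rightarrow> ('a \<Rightarrow>\<^sub>L 'a) \<times> 'a \<Rightarrow> 'a \<Rightarrow>\<^sub>L 'a" where
  "extend_proj E = (\<lambda>(P, x). P + outer_blinfun (sgn (blinfun_apply (proj E) x - blinfun_apply P x)))"

lemma borel_measurable_extend_proj [measurable]:
  "extend_proj E \<in> borel_measurable (borel \<Otimes>\<^sub>M borel)"
  unfolding extend_proj_def case_prod_beta by measurable

text \<open>The difference of the two projections of \<open>x\<close> lies in \<open>E\<close> and
  is orthogonal to \<open>F\<close>; when it is nonzero, adjoining its direction raises the
  dimension by exactly one.\<close>

lemma extend_proj_in:
  fixes E :: "'a::euclidean_space set"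
  assumes E: "subspace E" and F: "F \<in> grassmannian E m"
    and x: "blinfun_apply (proj E) x \<noteq> blinfun_apply (proj F) x"
  shows "extend_proj E (proj F, x) \<in> proj ` grassmannian E (Suc m)"
proof -
  note F' = grassmannianD[OF F]
  let ?w = "blinfun_apply (proj E) x - blinfun_apply (proj F) x"
  define v where "v = sgn ?w"
  have "?w \<in> E" using proj_in[OF E, of x] proj_in[OF F'(1), of x] F'(2) E by (auto intro: subspace_diff)
  then have vE: "v \<in> E" using E by (simp add: v_def sgn_div_norm subspace_scale)
  have "?w \<bullet> y = 0" if "y \<in> F" for y
    using proj_orthogonal[OF F'(1) that, of x] proj_orthogonal[OF E, of y x] F'(2) that
    by (auto simp: inner_diff_left)
  then have vF: "v \<bullet> y = 0" if "y \<in> F" for y using that by (simp add: v_def sgn_div_norm)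
  have vv: "v \<bullet> v = 1" using x by (simp add: v_def norm_eq_1[symmetric] norm_sgn)
  have "v \<notin> F" using vF vv by force
  let ?G = "span (insert v F)"
  have sub: "insert v F \<subseteq> E" using vE F'(2) by auto
  have "dim ?G = Suc m"
    using \<open>v \<notin> F\<close> F' by (simp add: dim_insert span_eq_iff[THEN iffD2])
  moreover have "?G \<subseteq> E" using span_minimal[OF sub E] .
  ultimately have G: "?G \<in> grassmannian E (Suc m)" by (simp add: grassmannian_def)
  have "proj ?G = extend_proj E (proj F, x)"
  proof (rule proj_eqI)
    have app: "blinfun_apply (extend_proj E (proj F, x)) y = blinfun_apply (proj F) y + (v \<bullet> y) *\<^sub>R v" for y
      by (simp add: extend_proj_def blinfun.add_left v_def)
    fix y
    have "blinfun_apply (proj F) y \<in> ?G"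
      using proj_in[OF F'(1), of y] by (simp add: span_base)
    then show "blinfun_apply (extend_proj E (proj F, x)) y \<in> ?G"
      unfolding app by (rule span_add) (simp add: span_scale span_base)
    fix z assume "z \<in> ?G"
    then have "orthogonal (y - blinfun_apply (extend_proj E (proj F, x)) y) z"
    proof (rule orthogonal_to_span)
      fix u assume "u \<in> insert v F"
      then consider "u = v" | "u \<in> F" by auto
      then show "orthogonal (y - blinfun_apply (extend_proj E (proj F, x)) y) u"
      proof cases
        case 1
        have "blinfun_apply (proj F) y \<bullet> v = 0"
          using vF[OF proj_in[OF F'(1)]] by (simp add: inner_commute)
        then show ?thesis
          using vv by (simp add: 1 app orthogonal_def inner_diff_left inner_add_left inner_commute[of y v])
      next
        case 2
        then show ?thesis
          using proj_orthogonal[OF F'(1) 2, of y] vF[OF 2]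
          by (simp add: app orthogonal_def inner_diff_left inner_add_left)
      qed
    qed
    then show "(y - blinfun_apply (extend_proj E (proj F, x)) y) \<bullet> z = 0" by (simp add: orthogonal_def)
  qed simp
  then show ?thesis using G by (metis image_eqI)
qed

text \<open>Gram-Schmidt uses only inner products and the projection onto \<open>E\<close>, both
  respected by \<open>T\<close>. This equivariance is the source of the invariance of the random
  subspace.\<close>

lemma conj_extend_proj:
  fixes E :: "'a::euclidean_space set"
  assumes T: "orthogonal_transformation T" "T ` E = E" and E: "subspace E"
  shows "conj_blinfun T (extend_proj E (P, x)) = extend_proj E (conj_blinfun T P, T x)"
proof (rule blinfun_eqI)
  fix y
  note lin = orthogonal_transformation_linear[OF T(1)]
  let ?v = "sgn (blinfun_apply (proj E) x - blinfun_apply P x)"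
  have "sgn (blinfun_apply (proj E) (T x) - blinfun_apply (conj_blinfun T P) (T x)) = T ?v"
    using proj_image[OF T(1) E, of x] T(2)
    by (simp add: conj_blinfun_apply[OF T(1)] orthogonal_transformation_inv_inv[OF T(1)]
        orthogonal_transformation_sgn[OF T(1), symmetric] linear_diff[OF lin])
  moreover have "T ?v \<bullet> y = ?v \<bullet> inv T y"
    using T(1) orthogonal_transformation_inv_inv(1)[OF T(1), of y]
    by (metis orthogonal_transformation_def)
  ultimately show "blinfun_apply (conj_blinfun T (extend_proj E (P, x))) y =
      blinfun_apply (extend_proj E (conj_blinfun T P, T x)) y"
    by (simp add: extend_proj_def conj_blinfun_apply[OF T(1)] blinfun.add_left
        linear_add[OF lin] linear_scale[OF lin])
qed

text \<open>The law of the projection onto a random subspace that is spanned by \<open>m\<close> independent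
  random vectors, each one orthogonalised against the span of the previous ones.\<close>
primrec random_proj :: "'a::euclidean_space set \<Rightarrow> nat \<Rightarrow> ('a \<Rightarrow>\<^sub>L 'a) measure" where
  "random_proj E 0 = return borel 0"
| "random_proj E (Suc m) = distr (random_proj E m \<Otimes>\<^sub>M ball_measure) borel (extend_proj E)"

lemma sets_random_proj [simp, measurable_cong]: "sets (random_proj E m) = sets borel"
  by (cases m) simp_all

lemma space_random_proj [simp]: "space (random_proj E m) = UNIV"
  by (cases m) simp_all

lemma measurable_extend_proj_random_proj [measurable]:
  "extend_proj E \<in> borel_measurable (random_proj E m \<Otimes>\<^sub>M ball_measure)"
  using borel_measurable_extend_proj
  by (subst measurable_cong_sets[OF sets_pair_measure_cong[of _ borel _ borel] refl]) auto

lemma prob_space_random_proj: "prob_space (random_proj E m)"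
proof (induction m)
  case 0
  show ?case by (simp add: prob_space_return)
next
  case (Suc m)
  interpret random_proj: prob_space "random_proj E m" by (rule Suc)
  interpret ball: prob_space "ball_measure :: 'a measure" by (rule prob_space_ball_measure)
  interpret pair_prob_space "random_proj E m" "ball_measure :: 'a measure" ..
  show ?case by (simp add: prob_space_distr)
qed

text \<open>Each step starts from a subspace of dimension below \<open>dim E\<close>, so the vectors
  that bring no new direction form a null set.\<close>

lemma AE_random_proj:
  fixes E :: "'a::euclidean_space set"
  assumes E: "subspace E"
  shows "m \<le> dim E \<Longrightarrow> AE P in random_proj E m. P \<in> proj ` grassmannian E m"
proof (induction m)
  case 0
  have "{0} \<in> grassmannian E 0" using E by (auto simp: grassmannian_def subspace_0)
  moreover have "proj {0} = (0 :: 'a \<Rightarrow>\<^sub>L 'a)" by (rule proj_eqI) auto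
  ultimately have "(0 :: 'a \<Rightarrow>\<^sub>L 'a) \<in> proj ` grassmannian E 0" by (metis image_eqI)
  moreover have "closed (proj ` grassmannian E 0)"
    by (rule compact_imp_closed[OF compact_proj_grassmannian[OF E]])
  then have [measurable]: "proj ` grassmannian E 0 \<in> sets borel" by simp
  ultimately show ?case unfolding random_proj.simps by (subst AE_return) simp_all
next
  case (Suc m)
  interpret random_proj: prob_space "random_proj E m" by (rule prob_space_random_proj)
  interpret ball: prob_space "ball_measure :: 'a measure" by (rule prob_space_ball_measure)
  interpret pair_prob_space "random_proj E m" "ball_measure :: 'a measure" ..
  have "closed (proj ` grassmannian E (Suc m))"
    by (rule compact_imp_closed[OF compact_proj_grassmannian[OF E]])
  then have [measurable]: "proj ` grassmannian E (Suc m) \<in> sets borel" by simp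
  have "AE Px in random_proj E m \<Otimes>\<^sub>M ball_measure. extend_proj E Px \<in> proj ` grassmannian E (Suc m)"
  proof (rule AE_pair_measure)
    have "AE P in random_proj E m. P \<in> proj ` grassmannian E m" using Suc by simp
    then show "AE P in random_proj E m. AE x in ball_measure. extend_proj E (P, x) \<in> proj ` grassmannian E (Suc m)"
    proof eventually_elim
      fix P assume "P \<in> proj ` grassmannian E m"
      then obtain F where F: "F \<in> grassmannian E m" "P = proj F" by auto
      have "AE x in ball_measure. blinfun_apply (proj E) x \<noteq> blinfun_apply (proj F) x"
        using grassmannianD[OF F(1)] Suc.prems by (intro AE_ball_measure_proj_neq E) auto
      then show "AE x in ball_measure. extend_proj E (P, x) \<in> proj ` grassmannian E (Suc m)"
        by eventually_elim (use extend_proj_in[OF E F(1)] F(2) in auto)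
    qed
  qed measurable
  then show ?case unfolding random_proj.simps by (subst AE_distr_iff) simp_all
qed

text \<open>By equivariance, conjugating after a step equals stepping from the conjugated operator
  and the rotated vector. That pair has the same product law, by induction and by rotation
  invariance of the ball.\<close>

lemma distr_random_proj:
  fixes E :: "'a::euclidean_space set"
  assumes T: "orthogonal_transformation T" "T ` E = E" and E: "subspace E"
  shows "distr (random_proj E m) borel (conj_blinfun T) = random_proj E m"
proof (induction m)
  case 0
  have "conj_blinfun T 0 = 0"
    by (rule blinfun_eqI) (simp add: conj_blinfun_apply[OF T(1)] linear_0[OF orthogonal_transformation_linear[OF T(1)]])
  then show ?case unfolding random_proj.simps by (subst distr_return) simp_all
next
  case (Suc m)
  interpret random_proj: prob_space "random_proj E m" by (rule prob_space_random_proj)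
  interpret ball: prob_space "ball_measure :: 'a measure" by (rule prob_space_ball_measure)
  note [measurable] = borel_measurable_orthogonal_transformation[OF T(1)]
  let ?M = "random_proj E m \<Otimes>\<^sub>M (ball_measure :: 'a measure)"
  have "distr (random_proj E (Suc m)) borel (conj_blinfun T) = distr ?M borel (\<lambda>p. conj_blinfun T (extend_proj E p))"
    by (simp add: distr_distr comp_def)
  also have "\<dots> = distr ?M borel (\<lambda>p. extend_proj E (case p of (P, x) \<Rightarrow> (conj_blinfun T P, T x)))"
    by (intro distr_cong) (auto simp: conj_extend_proj[OF T E])
  also have "\<dots> = distr (distr ?M (borel \<Otimes>\<^sub>M borel) (\<lambda>(P, x). (conj_blinfun T P, T x))) borel (extend_proj E)"
    by (subst distr_distr) (auto simp: comp_def)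
  also have "distr ?M (borel \<Otimes>\<^sub>M borel) (\<lambda>(P, x). (conj_blinfun T P, T x)) =
      distr (random_proj E m) borel (conj_blinfun T) \<Otimes>\<^sub>M distr ball_measure borel T"
    by (rule pair_measure_distr[symmetric])
      (simp_all add: distr_ball_measure[OF T(1)] ball.sigma_finite_measure_axioms)
  also have "\<dots> = ?M" by (simp add: Suc distr_ball_measure[OF T(1)])
  finally show ?case by simp
qed

lemma haar_on_grassmannian_exists:
  fixes E :: "'a::euclidean_space set"
  assumes E: "subspace E" and m: "m \<le> dim E"
  shows "\<exists>\<nu>. haar_on_grassmannian E m \<nu>"
proof -
  let ?X = "proj ` grassmannian E m"
  interpret random_proj: prob_space "random_proj E m" by (rule prob_space_random_proj)
  obtain F0 where F0: "F0 \<in> grassmannian E m" using grassmannian_nonempty[OF assms] by auto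
  \<comment> \<open>Recovers a subspace from its projection as the range. The value
    \<open>F0\<close> makes \<open>g\<close> total; \<open>random_proj\<close> almost surely avoids
    it as a default.\<close>
  define g where "g P = (if P \<in> ?X then range (blinfun_apply P) else F0)" for P :: "'a \<Rightarrow>\<^sub>L 'a"
  have g_proj: "g (proj F) = F" if "F \<in> grassmannian E m" for F
    using that by (auto simp: g_def range_proj grassmannianD)
  have "closed ?X" by (rule compact_imp_closed[OF compact_proj_grassmannian[OF E]])
  then have [measurable]: "?X \<in> sets borel" by simp
  have g_in: "g P \<in> grassmannian E m" for P
    using g_proj F0 by (cases "P \<in> ?X") (auto simp: g_def)
  have [measurable]: "g \<in> random_proj E m \<rightarrow>\<^sub>M grassmannian_borel E m"
  proof (rule measurable_into_grassmannian[OF refl g_in])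
    have "proj (g P) = (if P \<in> ?X then P else proj F0)" for P
      using g_proj by (auto simp: g_def)
    then show "(\<lambda>P. proj (g P)) \<in> borel_measurable (random_proj E m)" by simp
  qed
  let ?\<nu> = "distr (random_proj E m) (grassmannian_borel E m) g"
  have "distr ?\<nu> ?\<nu> (\<lambda>F. T ` F) = ?\<nu>" if T: "orthogonal_transformation T" "T ` E = E" for T
  proof -
    note [measurable] = measurable_image_grassmannian[OF T refl]
    have [measurable]: "g \<in> borel \<rightarrow>\<^sub>M grassmannian_borel E m"
      by (subst measurable_cong_sets[OF sets_random_proj[symmetric, of E m] refl]) measurable
    have "distr ?\<nu> ?\<nu> (\<lambda>F. T ` F) = distr ?\<nu> (grassmannian_borel E m) (\<lambda>F. T ` F)"
      by (intro distr_cong) auto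
    also have "\<dots> = distr (random_proj E m) (grassmannian_borel E m) (\<lambda>P. T ` g P)"
      by (subst distr_distr) (auto simp: comp_def)
    also have "\<dots> = distr (random_proj E m) (grassmannian_borel E m) (\<lambda>P. g (conj_blinfun T P))"
    \<comment> \<open>Equality holds only almost everywhere: off \<open>?X\<close> the map
      \<open>g\<close> is constantly \<open>F0\<close>, which \<open>T\<close> may move.\<close>
    proof (rule distr_cong_AE)
      show "AE P in random_proj E m. T ` g P = g (conj_blinfun T P)"
        using AE_random_proj[OF E m]
      proof eventually_elim
        fix P assume "P \<in> ?X"
        then obtain F where F: "F \<in> grassmannian E m" "P = proj F" by auto
        then show "T ` g P = g (conj_blinfun T P)"
          using orthogonal_transformation_image_grassmannian[OF T F(1)]
          by (simp add: g_proj proj_image_eq[OF T(1), symmetric] grassmannianD)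
      qed
    qed auto
    also have "\<dots> = distr (distr (random_proj E m) borel (conj_blinfun T)) (grassmannian_borel E m) g"
      by (subst distr_distr) (auto simp: comp_def)
    also have "\<dots> = ?\<nu>" by (simp add: distr_random_proj[OF T E])
    finally show ?thesis .
  qed
  then have "haar_on_grassmannian E m ?\<nu>"
    by (simp add: haar_on_grassmannian_def random_proj.prob_space_distr)
  then show ?thesis by blast
qed

lemma haar_on_grassmannian_haar:
  fixes E :: "'a::euclidean_space set"
  assumes "subspace E" "m \<le> dim E"
  shows "haar_on_grassmannian E m (grassmannian_haar E m)"
proof -
  have "\<exists>!\<nu>. haar_on_grassmannian E m \<nu>"
    by (rule ex_ex1I[OF haar_on_grassmannian_exists[OF assms] haar_on_grassmannian_unique[OF assms(1)]])
  then have "haar_on_grassmannian E m (THE \<nu>. haar_on_grassmannian E m \<nu>)" by (rule theI')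
  moreover have "(THE \<nu>. haar_on_grassmannian E m \<nu>) = grassmannian_haar E m"
    unfolding grassmannian_haar_def haar_on_grassmannian_def ..
  ultimately show ?thesis by simp
qed

lemma
  fixes E :: "'a::euclidean_space set"
  assumes "subspace E" "m \<le> dim E"
  shows prob_space_grassmannian_haar: "prob_space (grassmannian_haar E m)"
    and sets_grassmannian_haar: "sets (grassmannian_haar E m) = sets (grassmannian_borel E m)"
    and space_grassmannian_haar: "space (grassmannian_haar E m) = grassmannian E m"
    and distr_grassmannian_haar: "orthogonal_transformation T \<Longrightarrow> T ` E = E \<Longrightarrow>
      distr (grassmannian_haar E m) (grassmannian_haar E m) (\<lambda>F. T ` F) = grassmannian_haar E m"
  using haar_on_grassmannian_haar[OF assms] sets_eq_imp_space_eq[of "grassmannian_haar E m" "grassmannian_borel E m"]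
  by (auto simp: haar_on_grassmannian_def)

section \<open>The uniform measure on the sphere of a subspace\<close>

lemma distr_uniform_measure_invariant:
  fixes M :: "'a::topological_space measure"
  assumes M: "sets M = sets borel" "distr M borel T = M"
    and T: "T \<in> borel_measurable borel" and A: "A \<in> sets borel" "T -` A = A"
  shows "distr (uniform_measure M A) borel T = uniform_measure M A"
proof (rule measure_eqI)
  note [measurable_cong] = M(1) and [measurable] = T
  fix B assume "B \<in> sets (distr (uniform_measure M A) borel T)"
  then have B: "B \<in> sets borel" by simp
  have sp: "space M = UNIV" using sets_eq_imp_space_eq[OF M(1)] by simp
  have TB: "T -` B \<in> sets borel" using B measurable_sets[OF T, of B] by simp
  have "A \<inter> T -` B = T -` (A \<inter> B)" using A(2) by auto
  moreover have "emeasure M (T -` (A \<inter> B)) = emeasure (distr M borel T) (A \<inter> B)"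
    using A B by (subst emeasure_distr) (auto simp: sp)
  ultimately show "emeasure (distr (uniform_measure M A) borel T) B = emeasure (uniform_measure M A) B"
    using A B TB by (simp add: emeasure_distr M sp)
qed (simp add: M)

lemma AE_distr_borelI:
  assumes "f \<in> borel_measurable M" "A \<in> sets borel" "AE x in M. f x \<in> A"
  shows "AE y in distr M borel f. y \<in> A"
  using assms by (subst AE_distr_iff) auto

text \<open>The uniform probability measure on the unit sphere of \<open>F\<close> when
  \<open>0 < dim F\<close>. It projects from the ambient ball rather than from a ball in
  \<open>F\<close>, so that all \<open>F\<close> share one sample space.\<close>

definition sphere_law :: "'a::euclidean_space set \<Rightarrow> 'a measure" where
  "sphere_law F = distr ball_measure borel (\<lambda>x. sgn (blinfun_apply (proj F) x))"

lemma sets_sphere_law [simp, measurable_cong]: "sets (sphere_law F) = sets borel"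
  by (simp add: sphere_law_def)

lemma space_sphere_law [simp]: "space (sphere_law F) = UNIV"
  by (simp add: sphere_law_def)

lemma measurable_sgn_proj [measurable]:
  fixes P :: "'a::euclidean_space \<Rightarrow>\<^sub>L 'a"
  shows "(\<lambda>x. sgn (blinfun_apply P x)) \<in> borel_measurable ball_measure"
  by measurable

lemma prob_space_sphere_law: "prob_space (sphere_law F)"
  unfolding sphere_law_def
  by (rule prob_space.prob_space_distr[OF prob_space_ball_measure]) measurable

lemma borel_subspace_sphere [measurable]:
  fixes F :: "'a::euclidean_space set"
  shows "subspace F \<Longrightarrow> F \<inter> sphere 0 1 \<in> sets borel"
  by (intro borel_closed closed_Int closed_subspace closed_sphere)

lemma AE_sphere_law:
  fixes F :: "'a::euclidean_space set"
  assumes F: "subspace F" "0 < dim F"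
  shows "AE \<theta> in sphere_law F. \<theta> \<in> F \<inter> sphere 0 1"
proof -
  note [measurable] = borel_subspace_sphere[OF F(1)]
  have "AE x in ball_measure. sgn (blinfun_apply (proj F) x) \<in> F \<inter> sphere 0 1"
    using AE_ball_measure_proj_nonzero[OF F]
  proof eventually_elim
    fix x assume "blinfun_apply (proj F) x \<noteq> 0"
    then show "sgn (blinfun_apply (proj F) x) \<in> F \<inter> sphere 0 1"
      using proj_in[OF F(1), of x] F(1) by (auto simp: norm_sgn sgn_div_norm subspace_scale)
  qed
  then show ?thesis unfolding sphere_law_def by (intro AE_distr_borelI) measurable
qed

lemma distr_sphere_law:
  fixes F :: "'a::euclidean_space set"
  assumes T: "orthogonal_transformation T" "T ` F = F" and F: "subspace F"
  shows "distr (sphere_law F) borel T = sphere_law F"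
proof -
  note [measurable] = borel_measurable_orthogonal_transformation[OF T(1)]
  have "distr (sphere_law F) borel T = distr ball_measure borel (\<lambda>x. T (sgn (blinfun_apply (proj F) x)))"
    unfolding sphere_law_def by (subst distr_distr) (auto simp: comp_def)
  also have "\<dots> = distr ball_measure borel (\<lambda>x. sgn (blinfun_apply (proj F) (T x)))"
    using proj_image[OF T(1) F] T
    by (simp add: orthogonal_transformation_sgn[OF T(1), symmetric])
  also have "\<dots> = distr (distr ball_measure borel T) borel (\<lambda>x. sgn (blinfun_apply (proj F) x))"
    by (subst distr_distr) (auto simp: comp_def)
  also have "\<dots> = sphere_law F"
    by (simp add: distr_ball_measure[OF T(1)] sphere_law_def)
  finally show ?thesis .
qed

text \<open>Reflections inside \<open>F\<close> act transitively on its unit sphere, so an invariant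
  measure gives equal mass to equal balls centred there, and the uniqueness corollary
  applies.\<close>

lemma sphere_law_eqI:
  fixes F :: "'a::euclidean_space set"
  assumes F: "subspace F" "0 < dim F" and M: "sets M = sets borel" "prob_space M"
    and AE: "AE \<theta> in M. \<theta> \<in> F \<inter> sphere 0 1"
    and inv: "\<And>T. orthogonal_transformation T \<Longrightarrow> T ` F = F \<Longrightarrow> distr M borel T = M"
  shows "M = sphere_law F"
proof -
  have *: "emeasure N (cball u r) = emeasure N (cball v r)"
    if N: "sets N = sets borel" "\<And>T. orthogonal_transformation T \<Longrightarrow> T ` F = F \<Longrightarrow> distr N borel T = N"
      and uv: "u \<in> F \<inter> sphere 0 1" "v \<in> F \<inter> sphere 0 1" for N u v r
  proof -
    obtain T where T: "orthogonal_transformation T" "T ` F = F" "T u = v"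
      by (rule orthogonal_transformation_map_unit_vector[OF F(1) uv])
    have "emeasure N (cball v r) = emeasure (distr N borel T) (cball v r)"
      using N(2)[OF T(1,2)] by simp
    also have "\<dots> = emeasure N (T -` cball v r \<inter> space N)"
      using borel_measurable_orthogonal_transformation[OF T(1)]
      by (intro emeasure_distr) (auto simp: measurable_cong_sets[OF N(1) refl])
    also have "T -` cball v r \<inter> space N = cball u r"
      using orthogonal_transformation_vimage_cball[OF T(1), of u r] T(3) sets_eq_imp_space_eq[OF N(1)] by simp
    finally show ?thesis ..
  qed
  have UNIV: "space M = UNIV" using sets_eq_imp_space_eq[OF M(1)] by simp
  have cpt: "compact (F \<inter> sphere 0 1)" by (intro closed_Int_compact closed_subspace F compact_sphere)
  have one: "emeasure M UNIV = 1" "emeasure (sphere_law F) UNIV = 1"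
    using prob_space.emeasure_space_1[OF M(2)] prob_space.emeasure_space_1[OF prob_space_sphere_law, of F] UNIV
    by simp_all
  show ?thesis
    by (rule uniformly_distributed_finite_measure_eqI[OF M(1) sets_sphere_law one _ _ AE AE_sphere_law[OF F] cpt
          *[OF M(1) inv] *[OF sets_sphere_law distr_sphere_law[OF _ _ F(1)]]]) simp_all
qed

lemma emeasure_punctured_ball:
  fixes F :: "'a::euclidean_space set"
  assumes F: "subspace F" "0 < dim F"
  shows "emeasure (subspace_lborel F) (F \<inter> cball 0 1 - {0}) = ennreal (unit_ball_vol (dim F))"
proof -
  have "closed F" by (rule closed_subspace[OF F(1)])
  then have "F \<inter> cball 0 1 - {0} \<in> sets borel" by (intro sets.Diff sets.Int borel_closed) auto
  then have "emeasure (subspace_lborel F) (F \<inter> cball 0 1 - {0}) = emeasure (subspace_lborel F) (cball 0 1)"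
    using AE_subspace_lborel[OF F(1)] AE_subspace_lborel_nonzero[OF F]
    by (intro emeasure_eq_AE) auto
  also have "\<dots> = ennreal (unit_ball_vol (dim F))"
    using emeasure_subspace_lborel_cball[OF F(1) subspace_0[OF F(1)], of 1] by simp
  finally show ?thesis .
qed

text \<open>Radial projection of the punctured unit ball of \<open>F\<close> is invariant as well,
  hence has the same law. This links the convenient description by ambient projections with the cone
  volumes in \<open>sphere_measure\<close>.\<close>

lemma sphere_law_subspace_lborel:
  fixes F :: "'a::euclidean_space set"
  assumes F: "subspace F" "0 < dim F"
  shows "sphere_law F = distr (uniform_measure (subspace_lborel F) (F \<inter> cball 0 1 - {0})) borel sgn"
proof (rule sphere_law_eqI[symmetric, OF F])
  let ?A = "F \<inter> cball 0 1 - {0}"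
  have "closed F" by (rule closed_subspace[OF F(1)])
  then have A [measurable]: "?A \<in> sets borel" by (intro sets.Diff sets.Int borel_closed) auto
  note [measurable] = borel_subspace_sphere[OF F(1)]
  let ?U = "uniform_measure (subspace_lborel F) ?A"
  have "prob_space ?U"
    by (rule prob_space_uniform_measure) (simp_all add: emeasure_punctured_ball[OF F])
  then show "prob_space (distr ?U borel sgn)" by (rule prob_space.prob_space_distr) simp
  have "AE x in ?U. sgn x \<in> F \<inter> sphere 0 1"
    using A F(1) by (intro AE_uniform_measureI) (auto simp: norm_sgn sgn_div_norm subspace_scale)
  then show "AE \<theta> in distr ?U borel sgn. \<theta> \<in> F \<inter> sphere 0 1"
    by (intro AE_distr_borelI) measurable
  fix T :: "'a \<Rightarrow> 'a" assume T: "orthogonal_transformation T" "T ` F = F"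
  note [measurable] = borel_measurable_orthogonal_transformation[OF T(1)]
  have "T x \<in> F \<longleftrightarrow> x \<in> F" for x
    using T orthogonal_transformation_inj[OF T(1)] by (metis inj_image_mem_iff)
  moreover have "T x = 0 \<longleftrightarrow> x = 0" for x
    using orthogonal_transformation_norm[OF T(1), of x] by (metis norm_eq_zero)
  ultimately have "T -` ?A = ?A"
    using orthogonal_transformation_norm[OF T(1)] by auto
  then have U: "distr ?U borel T = ?U"
    using distr_subspace_lborel[OF T(1) F(1)] T(2)
    by (intro distr_uniform_measure_invariant A) simp_all
  have "distr (distr ?U borel sgn) borel T = distr ?U borel (\<lambda>x. sgn (T x))"
    by (subst distr_distr) (auto simp: comp_def orthogonal_transformation_sgn[OF T(1)])
  also have "\<dots> = distr (distr ?U borel T) borel sgn"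
    by (subst distr_distr) (auto simp: comp_def)
  finally show "distr (distr ?U borel sgn) borel T = distr ?U borel sgn" by (simp add: U)
qed simp

lemma nn_integral_sphere_law:
  fixes F :: "'a::euclidean_space set"
  assumes F: "subspace F" "0 < dim F" and [measurable]: "f \<in> borel_measurable borel"
  shows "ennreal (unit_ball_vol (dim F)) * (\<integral>\<^sup>+\<theta>. f \<theta> \<partial>sphere_law F) =
    (\<integral>\<^sup>+x. indicator (F \<inter> cball 0 1 - {0}) x * f (sgn x) \<partial>subspace_lborel F)"
proof -
  let ?A = "F \<inter> cball 0 1 - {0}"
  have "closed F" by (rule closed_subspace[OF F(1)])
  then have [measurable]: "?A \<in> sets borel" by (intro sets.Diff sets.Int borel_closed) auto
  have "(\<integral>\<^sup>+\<theta>. f \<theta> \<partial>sphere_law F) = (\<integral>\<^sup>+x. f (sgn x) \<partial>uniform_measure (subspace_lborel F) ?A)"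
    unfolding sphere_law_subspace_lborel[OF F] by (subst nn_integral_distr) simp_all
  also have "\<dots> = (\<integral>\<^sup>+x. f (sgn x) * indicator ?A x \<partial>subspace_lborel F) / ennreal (unit_ball_vol (dim F))"
    by (subst nn_integral_uniform_measure) (simp_all add: emeasure_punctured_ball[OF F])
  finally have *: "(\<integral>\<^sup>+\<theta>. f \<theta> \<partial>sphere_law F) =
    (\<integral>\<^sup>+x. f (sgn x) * indicator ?A x \<partial>subspace_lborel F) / ennreal (unit_ball_vol (dim F))" .
  have "c * (I / c) = I" if "c \<noteq> 0" "c \<noteq> \<infinity>" for c I :: ennreal
    using ennreal_mult_divide_eq[of c I] that by (simp add: ennreal_times_divide mult.commute)
  then show ?thesis unfolding * by (simp add: mult.commute)
qed

text \<open>The factor is the surface area of the unit sphere of \<open>F\<close>: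
  \<open>dim F\<close> is the density in \<open>sphere_measure\<close>, and the unit ball volume
  undoes the normalisation of \<open>sphere_law\<close>.\<close>

lemma integral_sphere_measure:
  fixes F :: "'a::euclidean_space set" and g :: "'a \<Rightarrow> real"
  assumes F: "subspace F" "0 < dim F" and [measurable]: "g \<in> borel_measurable borel"
  shows "(LINT \<theta>|sphere_measure F. g \<theta>) = dim F * unit_ball_vol (dim F) * (LINT \<theta>|sphere_law F. g \<theta>)"
proof -
  let ?A = "F \<inter> cball 0 1 - {0}" and ?L = "subspace_lborel F"
  have "closed F" by (rule closed_subspace[OF F(1)])
  then have A [measurable]: "?A \<in> sets borel" by (intro sets.Diff sets.Int borel_closed) auto
  have sgn: "sgn \<in> restrict_space ?L ?A \<rightarrow>\<^sub>M restrict_space borel (F \<inter> sphere 0 1)"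
    using F(1)
    by (intro measurable_restrict_space3) (auto simp: norm_sgn sgn_div_norm subspace_scale)
  have g: "g \<in> borel_measurable (restrict_space borel (F \<inter> sphere 0 1))"
    by (rule measurable_restrict_space1) simp
  have g': "g \<in> borel_measurable (distr (restrict_space ?L ?A) (restrict_space borel (F \<inter> sphere 0 1)) sgn)"
    using g by simp
  have "(LINT \<theta>|sphere_measure F. g \<theta>) =
      (LINT \<theta>|distr (restrict_space ?L ?A) (restrict_space borel (F \<inter> sphere 0 1)) sgn. real (dim F) *\<^sub>R g \<theta>)"
    unfolding sphere_measure_def ennreal_of_nat_eq_real_of_nat
    using g' by (intro integral_density) auto
  also have "\<dots> = dim F * (LINT x|?L. indicator ?A x *\<^sub>R g (sgn x))"
    using sgn g by (simp add: integral_distr integral_restrict_space)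
  also have "(LINT x|?L. indicator ?A x *\<^sub>R g (sgn x)) =
      unit_ball_vol (dim F) * (LINT x|?L. (indicator ?A x / unit_ball_vol (dim F)) *\<^sub>R g (sgn x))"
  proof -
    have "(LINT x|?L. (indicator ?A x / unit_ball_vol (dim F)) *\<^sub>R g (sgn x)) =
        (LINT x|?L. (1 / unit_ball_vol (dim F)) * (indicator ?A x *\<^sub>R g (sgn x)))"
      by (rule Bochner_Integration.integral_cong) auto
    also have "\<dots> = (1 / unit_ball_vol (dim F)) * (LINT x|?L. indicator ?A x *\<^sub>R g (sgn x))"
      by (rule integral_mult_right_zero)
    finally show ?thesis by simp
  qed
  also have "(LINT x|?L. (indicator ?A x / unit_ball_vol (dim F)) *\<^sub>R g (sgn x)) =
      (LINT x|uniform_measure ?L ?A. g (sgn x))"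
  proof -
    have "uniform_measure ?L ?A = density ?L (\<lambda>x. ennreal (indicator ?A x / unit_ball_vol (dim F)))"
      unfolding uniform_measure_def emeasure_punctured_ball[OF F]
      by (intro density_cong) (auto simp: divide_ennreal[symmetric] ennreal_indicator)
    then show ?thesis by (subst integral_density[symmetric]) auto
  qed
  also have "(LINT x|uniform_measure ?L ?A. g (sgn x)) = (LINT \<theta>|sphere_law F. g \<theta>)"
    unfolding sphere_law_subspace_lborel[OF F] by (subst integral_distr) simp_all
  finally show ?thesis by simp
qed

section \<open>Polar coordinates\<close>

lemma nn_integral_power_Icc:
  assumes "0 < m" "0 \<le> h"
  shows "(\<integral>\<^sup>+t. ennreal (t ^ (m - 1)) * indicator {0..h} t \<partial>lborel) = ennreal (h ^ m / real m)"
proof -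
  have "(\<integral>\<^sup>+t. ennreal (t ^ (m - 1)) * indicator {0..h} t \<partial>lborel) =
      ennreal (h ^ m / real m - 0 ^ m / real m)"
    using assms
    by (intro nn_integral_FTC_Icc[where F = "\<lambda>t. t ^ m / real m"])
      (auto intro!: derivative_eq_intros)
  then show ?thesis using assms by (simp add: zero_power)
qed

text \<open>Polar coordinates without a product decomposition: integrate \<open>1/t\<close> over
  \<open>{(x, t). 0 < norm x \<le> t \<le> h x}\<close> in both orders, and use that \<open>dt/t\<close> is invariant under the
  substitution \<open>t = h x * s\<close>.\<close>
lemma emeasure_polar:
  fixes F :: "'a::euclidean_space set" and h :: "'a \<Rightarrow> real"
  assumes F: "subspace F" "0 < dim F"
    and [measurable]: "h \<in> borel_measurable borel"
    and h: "\<And>x. 0 < h x" "\<And>c x. 0 < c \<Longrightarrow> h (c *\<^sub>R x) = h x"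
  shows "emeasure (subspace_lborel F) {x. x \<noteq> 0 \<and> norm x \<le> h x} =
    (\<integral>\<^sup>+x. indicator (cball 0 1 - {0}) x * ennreal (h x ^ dim F) \<partial>subspace_lborel F)"
proof -
  let ?L = "subspace_lborel F" and ?m = "dim F"
  interpret L: sigma_finite_measure ?L by (rule sigma_finite_subspace_lborel[OF F(1)])
  interpret pair_sigma_finite ?L "lborel :: real measure" ..
  let ?V = "emeasure ?L {x. x \<noteq> 0 \<and> norm x \<le> h x}"
  let ?J = "{p. fst p \<noteq> 0 \<and> norm (fst p) \<le> 1 \<and> 0 < snd p \<and> snd p \<le> h (fst p)}"
  let ?k = "\<lambda>(x, t). ennreal (1 / t) * indicator {p. fst p \<noteq> 0 \<and> norm (fst p) \<le> snd p \<and> snd p \<le> h (fst p)} (x, t)"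
  \<comment> \<open>Dilating the slice at height c to unit scale trades the weight 1/c for c to the
    power \<open>dim F - 1\<close>; \<open>h\<close> is unaffected because it depends only on the
    direction.\<close>
  have scale: "ennreal (1 / c) * emeasure ?L A = ennreal (c ^ (?m - 1)) * emeasure ?L ((\<lambda>x. c *\<^sub>R x) -` A)"
    if c: "0 < c" and A: "A \<in> sets borel" for c A
  proof -
    have "(1 / c) * c ^ ?m = c ^ (?m - 1)" using c F(2) by (simp add: power_diff field_simps)
    then have "ennreal (1 / c) * ennreal (c ^ ?m) = ennreal (c ^ (?m - 1))"
      using c by (simp add: ennreal_mult[symmetric])
    then show ?thesis
      unfolding emeasure_subspace_lborel_scale[OF F(1) c A] by (simp add: mult.assoc[symmetric])
  qed
  have "(\<integral>\<^sup>+x. \<integral>\<^sup>+t. ?k (x, t) \<partial>lborel \<partial>?L) = (\<integral>\<^sup>+t. \<integral>\<^sup>+x. ?k (x, t) \<partial>?L \<partial>lborel)"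
    by (rule Fubini'[symmetric]) measurable
  also have "\<dots> = (\<integral>\<^sup>+t. \<integral>\<^sup>+x. ennreal (t ^ (?m - 1)) * indicator ?J (x, t) \<partial>?L \<partial>lborel)"
  proof (rule nn_integral_cong)
    fix t :: real
    show "(\<integral>\<^sup>+x. ?k (x, t) \<partial>?L) =
        (\<integral>\<^sup>+x. ennreal (t ^ (?m - 1)) * indicator ?J (x, t) \<partial>?L)"
    proof (cases "0 < t")
      case True
      let ?S = "{x. x \<noteq> 0 \<and> norm x \<le> t \<and> t \<le> h x}"
      have S: "?S \<in> sets borel" by measurable
      have S': "(\<lambda>x. t *\<^sub>R x) -` ?S \<in> sets borel"
        using measurable_sets[of "\<lambda>x. t *\<^sub>R x" borel borel ?S] S by simp
      have "(\<integral>\<^sup>+x. ?k (x, t) \<partial>?L) = (\<integral>\<^sup>+x. ennreal (1 / t) * indicator ?S x \<partial>?L)"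
        by (intro nn_integral_cong) (auto simp: indicator_def)
      also have "\<dots> = ennreal (1 / t) * emeasure ?L ?S" using S by (simp add: nn_integral_cmult_indicator)
      also have "\<dots> = ennreal (t ^ (?m - 1)) * emeasure ?L ((\<lambda>x. t *\<^sub>R x) -` ?S)" by (rule scale[OF True S])
      also have "\<dots> = (\<integral>\<^sup>+x. ennreal (t ^ (?m - 1)) * indicator ((\<lambda>x. t *\<^sub>R x) -` ?S) x \<partial>?L)"
        using S' by (simp add: nn_integral_cmult_indicator)
      also have "\<dots> = (\<integral>\<^sup>+x. ennreal (t ^ (?m - 1)) * indicator ?J (x, t) \<partial>?L)"
        using True h(2)[OF True] by (intro nn_integral_cong) (auto simp: indicator_def)
      finally show ?thesis .
    next
      case False
      have 0: "?k (x, t) = 0" for x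
      proof (cases "x = 0")
        case x: False
        then have "0 < norm x" by simp
        with False have "\<not> norm x \<le> t" by linarith
        then show ?thesis by simp
      qed simp
      have "indicator ?J (x, t) = (0 :: ennreal)" for x using False by simp
      then show ?thesis unfolding 0 by (simp only: mult_zero_right)
    qed
  qed
  also have "\<dots> = (\<integral>\<^sup>+x. \<integral>\<^sup>+t. ennreal (t ^ (?m - 1)) * indicator ?J (x, t) \<partial>lborel \<partial>?L)"
    by (rule Fubini') measurable
  also have "\<dots> = (\<integral>\<^sup>+x. ennreal (1 / ?m) * (indicator (cball 0 1 - {0}) x * ennreal (h x ^ ?m)) \<partial>?L)"
  proof (rule nn_integral_cong)
    fix x
    have "(\<integral>\<^sup>+t. ennreal (t ^ (?m - 1)) * indicator {0<..h x} t \<partial>lborel) =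
        (\<integral>\<^sup>+t. ennreal (t ^ (?m - 1)) * indicator {0..h x} t \<partial>lborel)"
      using AE_lborel_singleton[of "0 :: real"] by (intro nn_integral_cong_AE) (auto simp: indicator_def)
    also have "\<dots> = ennreal (1 / ?m) * ennreal (h x ^ ?m)"
      using h(1)[of x] nn_integral_power_Icc[OF F(2), of "h x"] by (simp add: ennreal_mult[symmetric])
    finally have *: "(\<integral>\<^sup>+t. ennreal (t ^ (?m - 1)) * indicator {0<..h x} t \<partial>lborel) =
      ennreal (1 / ?m) * ennreal (h x ^ ?m)" .
    have "(\<integral>\<^sup>+t. ennreal (t ^ (?m - 1)) * indicator ?J (x, t) \<partial>lborel) =
        (\<integral>\<^sup>+t. indicator (cball 0 1 - {0}) x * (ennreal (t ^ (?m - 1)) * indicator {0<..h x} t) \<partial>lborel)"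
      by (rule nn_integral_cong) (auto simp: indicator_def)
    also have "\<dots> = indicator (cball 0 1 - {0}) x * (ennreal (1 / ?m) * ennreal (h x ^ ?m))"
      unfolding *[symmetric] by (rule nn_integral_cmult) measurable
    finally show "(\<integral>\<^sup>+t. ennreal (t ^ (?m - 1)) * indicator ?J (x, t) \<partial>lborel) =
        ennreal (1 / ?m) * (indicator (cball 0 1 - {0}) x * ennreal (h x ^ ?m))"
      by (simp only: mult.left_commute)
  qed
  also have "\<dots> = ennreal (1 / ?m) * (\<integral>\<^sup>+x. indicator (cball 0 1 - {0}) x * ennreal (h x ^ ?m) \<partial>?L)"
  proof (rule nn_integral_cmult)
    have "cball 0 1 - {0} \<in> sets ?L" by simp
    moreover have "(\<lambda>x. ennreal (h x ^ ?m)) \<in> borel_measurable ?L" by measurable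
    ultimately show "(\<lambda>x. indicator (cball 0 1 - {0}) x * ennreal (h x ^ ?m)) \<in> borel_measurable ?L"
      by (intro borel_measurable_times_ennreal borel_measurable_indicator)
  qed
  finally have W: "(\<integral>\<^sup>+x. \<integral>\<^sup>+t. ?k (x, t) \<partial>lborel \<partial>?L) =
    ennreal (1 / ?m) * (\<integral>\<^sup>+x. indicator (cball 0 1 - {0}) x * ennreal (h x ^ ?m) \<partial>?L)" .
  have "(\<integral>\<^sup>+x. \<integral>\<^sup>+t. ?k (x, t) \<partial>lborel \<partial>?L) =
      (\<integral>\<^sup>+x. \<integral>\<^sup>+s. ennreal (1 / s) * indicator {p. fst p \<noteq> 0 \<and> norm (fst p) \<le> snd p * h (fst p) \<and> snd p \<le> 1} (x, s) \<partial>lborel \<partial>?L)"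
  proof (rule nn_integral_cong)
    fix x
    have hx: "0 < h x" by (rule h)
    have "?k (x, t) = ennreal (1 / t) * indicator {t. x \<noteq> 0 \<and> norm x \<le> t \<and> t \<le> h x} t" for t
      by (simp add: indicator_def)
    then have kx: "(\<lambda>t. ?k (x, t)) \<in> borel_measurable borel" by (simp only:) measurable
    have "(\<integral>\<^sup>+t. ?k (x, t) \<partial>lborel) = ennreal \<bar>h x\<bar> * (\<integral>\<^sup>+s. ?k (x, 0 + h x * s) \<partial>lborel)"
      using hx by (intro nn_integral_real_affine kx) simp
    also have "\<dots> = (\<integral>\<^sup>+s. ennreal \<bar>h x\<bar> * ?k (x, 0 + h x * s) \<partial>lborel)"
      by (rule nn_integral_cmult[symmetric], rule measurable_compose[OF _ kx, where f = "\<lambda>s. 0 + h x * s"])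
        measurable
    also have "\<dots> = (\<integral>\<^sup>+s. ennreal (1 / s) * indicator {p. fst p \<noteq> 0 \<and> norm (fst p) \<le> snd p * h (fst p) \<and> snd p \<le> 1} (x, s) \<partial>lborel)"
    proof (rule nn_integral_cong)
      fix s
      have "ennreal \<bar>h x\<bar> * ennreal (1 / (h x * s)) = ennreal (1 / s)"
        using hx by (simp add: ennreal_mult'[symmetric])
      then show "ennreal \<bar>h x\<bar> * ?k (x, 0 + h x * s) =
          ennreal (1 / s) * indicator {p. fst p \<noteq> 0 \<and> norm (fst p) \<le> snd p * h (fst p) \<and> snd p \<le> 1} (x, s)"
        using hx by (auto simp: indicator_def mult.commute)
    qed
    finally show "(\<integral>\<^sup>+t. ?k (x, t) \<partial>lborel) = \<dots>" .
  qed
  also have "\<dots> = (\<integral>\<^sup>+s. \<integral>\<^sup>+x. ennreal (1 / s) * indicator {p. fst p \<noteq> 0 \<and> norm (fst p) \<le> snd p * h (fst p) \<and> snd p \<le> 1} (x, s) \<partial>?L \<partial>lborel)"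
    by (rule Fubini'[symmetric]) measurable
  also have "\<dots> = (\<integral>\<^sup>+s. ?V * (ennreal (s ^ (?m - 1)) * indicator {0..1} s) \<partial>lborel)"
  proof (rule nn_integral_cong_AE, use AE_lborel_singleton[of "0 :: real"] in eventually_elim)
    fix s :: real assume "s \<noteq> 0"
    show "(\<integral>\<^sup>+x. ennreal (1 / s) * indicator {p. fst p \<noteq> 0 \<and> norm (fst p) \<le> snd p * h (fst p) \<and> snd p \<le> 1} (x, s) \<partial>?L) =
        ?V * (ennreal (s ^ (?m - 1)) * indicator {0..1} s)"
    proof (cases "0 < s \<and> s \<le> 1")
      case True
      \<comment> \<open>This slice is the set of volume \<open>?V\<close> dilated by s. It
        contributes s to the power \<open>dim F - 1\<close> times \<open>?V\<close>, and integrating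
        s over the unit interval leaves \<open>?V\<close> divided by \<open>dim F\<close>.\<close>
      let ?S = "{x. x \<noteq> 0 \<and> norm x \<le> s * h x}"
      have S: "?S \<in> sets borel" by measurable
      have "(\<integral>\<^sup>+x. ennreal (1 / s) * indicator {p. fst p \<noteq> 0 \<and> norm (fst p) \<le> snd p * h (fst p) \<and> snd p \<le> 1} (x, s) \<partial>?L) =
          (\<integral>\<^sup>+x. ennreal (1 / s) * indicator ?S x \<partial>?L)"
        using True by (intro nn_integral_cong) (auto simp: indicator_def)
      also have "\<dots> = ennreal (1 / s) * emeasure ?L ?S" using S by (simp add: nn_integral_cmult_indicator)
      also have "\<dots> = ennreal (s ^ (?m - 1)) * emeasure ?L ((\<lambda>x. s *\<^sub>R x) -` ?S)"
        using True by (intro scale S) simp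
      also have "(\<lambda>x. s *\<^sub>R x) -` ?S = {x. x \<noteq> 0 \<and> norm x \<le> h x}"
        using True h(2)[of s] by auto
      finally show ?thesis using True by (simp add: mult.commute)
    next
      case False
      have 0: "indicator {p. fst p \<noteq> 0 \<and> norm (fst p) \<le> snd p * h (fst p) \<and> snd p \<le> 1} (x, s) = (0 :: ennreal)" for x
      proof (cases "s \<le> 0")
        case True
        then have "s * h x \<le> 0" using h(1)[of x] by (simp add: mult_nonpos_nonneg less_imp_le)
        then show ?thesis by (auto simp: indicator_def dest: order_trans)
      qed (use False in \<open>auto simp: indicator_def\<close>)
      have "indicator {0..1} s = (0 :: ennreal)" using False \<open>s \<noteq> 0\<close> by auto
      with 0 show ?thesis by (simp only: mult_zero_right nn_integral_const mult_zero_left)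
    qed
  qed
  also have "\<dots> = ?V * ennreal (1 / ?m)"
    using nn_integral_power_Icc[OF F(2), of 1] by (subst nn_integral_cmult) simp_all
  finally have "ennreal (1 / ?m) * ?V =
      ennreal (1 / ?m) * (\<integral>\<^sup>+x. indicator (cball 0 1 - {0}) x * ennreal (h x ^ ?m) \<partial>?L)"
    using W by (simp add: mult.commute)
  moreover have "0 < 1 / real ?m" using F(2) by simp
  then have "ennreal (1 / ?m) \<noteq> 0" by (metis ennreal_eq_0_iff not_le)
  ultimately show ?thesis unfolding ennreal_mult_cancel_left by simp
qed

text \<open>The random subspace and the random ball point are independent and both invariant, and
  projection is equivariant. So the resulting direction has an invariant law on the sphere of
  \<open>E\<close>, and there is only one such law.\<close>

lemma sphere_law_average:
  fixes E :: "'a::euclidean_space set"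
  assumes E: "subspace E" and m: "0 < m" "m \<le> dim E"
  shows "distr (grassmannian_haar E m \<Otimes>\<^sub>M ball_measure) borel (\<lambda>(F, x). sgn (blinfun_apply (proj F) x)) =
    sphere_law E"
proof (rule sphere_law_eqI[OF E])
  let ?\<nu> = "grassmannian_haar E m"
  interpret haar: prob_space ?\<nu> by (rule prob_space_grassmannian_haar[OF E m(2)])
  interpret ball: prob_space "ball_measure :: 'a measure" by (rule prob_space_ball_measure)
  interpret pair_prob_space ?\<nu> "ball_measure :: 'a measure" ..
  note sp = space_grassmannian_haar[OF E m(2)] and sets = sets_grassmannian_haar[OF E m(2)]
  note [measurable] = measurable_proj[OF sets] borel_subspace_sphere[OF E]
  let ?f = "\<lambda>(F, x). sgn (blinfun_apply (proj F) x)"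
  have f [measurable]: "?f \<in> borel_measurable (?\<nu> \<Otimes>\<^sub>M ball_measure)" by measurable
  show "0 < dim E" using m by simp
  show "prob_space (distr (?\<nu> \<Otimes>\<^sub>M ball_measure) borel ?f)" by (rule prob_space_distr) measurable
  have "AE p in ?\<nu> \<Otimes>\<^sub>M ball_measure. ?f p \<in> E \<inter> sphere 0 1"
  proof (rule AE_pair_measure)
    show "AE F in ?\<nu>. AE x in ball_measure. ?f (F, x) \<in> E \<inter> sphere 0 1"
    proof (rule AE_I2)
      fix F assume "F \<in> space ?\<nu>"
      then have "F \<in> grassmannian E m" by (simp add: sp)
      note F = grassmannianD[OF this]
      have "AE x in ball_measure. blinfun_apply (proj F) x \<noteq> 0"
        using F m by (intro AE_ball_measure_proj_nonzero) auto
      then show "AE x in ball_measure. ?f (F, x) \<in> E \<inter> sphere 0 1"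
      proof eventually_elim
        fix x assume "blinfun_apply (proj F) x \<noteq> 0"
        then show "?f (F, x) \<in> E \<inter> sphere 0 1"
          using proj_in[OF F(1), of x] subsetD[OF F(2)] E by (simp add: norm_sgn sgn_div_norm subspace_scale)
      qed
    qed
  qed measurable
  then show "AE \<theta> in distr (?\<nu> \<Otimes>\<^sub>M ball_measure) borel ?f. \<theta> \<in> E \<inter> sphere 0 1"
    by (intro AE_distr_borelI) measurable
  fix T :: "'a \<Rightarrow> 'a" assume T: "orthogonal_transformation T" "T ` E = E"
  note [measurable] = borel_measurable_orthogonal_transformation[OF T(1)] measurable_image_grassmannian[OF T sets]
  have "distr (distr (?\<nu> \<Otimes>\<^sub>M ball_measure) borel ?f) borel T = distr (?\<nu> \<Otimes>\<^sub>M ball_measure) borel (\<lambda>p. T (?f p))"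
    by (subst distr_distr) (auto simp: comp_def)
  also have "\<dots> = distr (?\<nu> \<Otimes>\<^sub>M ball_measure) borel (\<lambda>p. ?f (case p of (F, x) \<Rightarrow> (T ` F, T x)))"
    by (intro distr_cong)
      (auto simp: space_pair_measure sp grassmannianD proj_image[OF T(1)] orthogonal_transformation_sgn[OF T(1)])
  also have "\<dots> = distr (distr (?\<nu> \<Otimes>\<^sub>M ball_measure) (?\<nu> \<Otimes>\<^sub>M borel) (\<lambda>(F, x). (T ` F, T x))) borel ?f"
    by (subst distr_distr) (auto simp: comp_def)
  also have "distr (?\<nu> \<Otimes>\<^sub>M ball_measure) (?\<nu> \<Otimes>\<^sub>M borel) (\<lambda>(F, x). (T ` F, T x)) =
      distr ?\<nu> ?\<nu> (\<lambda>F. T ` F) \<Otimes>\<^sub>M distr ball_measure borel T"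
    by (rule pair_measure_distr[symmetric])
      (simp_all add: distr_ball_measure[OF T(1)] ball.sigma_finite_measure_axioms)
  also have "\<dots> = ?\<nu> \<Otimes>\<^sub>M ball_measure"
    by (simp add: distr_ball_measure[OF T(1)] distr_grassmannian_haar[OF E m(2) T])
  finally show "distr (distr (?\<nu> \<Otimes>\<^sub>M ball_measure) borel ?f) borel T = distr (?\<nu> \<Otimes>\<^sub>M ball_measure) borel ?f" .
qed simp

lemma integral_sphere_law:
  "g \<in> borel_measurable borel \<Longrightarrow>
    (LINT \<theta>|sphere_law F. g \<theta>) = (LINT x|ball_measure. g (sgn (blinfun_apply (proj F) x)) :: real)"
  unfolding sphere_law_def by (rule integral_distr) measurable

lemma integral_sphere_law_average:
  fixes E :: "'a::euclidean_space set" and g :: "'a \<Rightarrow> real"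
  assumes E: "subspace E" and m: "0 < m" "m \<le> dim E"
    and g [measurable]: "g \<in> borel_measurable borel" and B: "\<And>x. \<bar>g x\<bar> \<le> B"
  shows "(LINT F|grassmannian_haar E m. LINT \<theta>|sphere_law F. g \<theta>) = (LINT \<theta>|sphere_law E. g \<theta>)"
proof -
  let ?\<nu> = "grassmannian_haar E m"
  interpret haar: prob_space ?\<nu> by (rule prob_space_grassmannian_haar[OF E m(2)])
  interpret ball: prob_space "ball_measure :: 'a measure" by (rule prob_space_ball_measure)
  interpret pair_prob_space ?\<nu> "ball_measure :: 'a measure" ..
  note [measurable] = measurable_proj[OF sets_grassmannian_haar[OF E m(2)]]
  have "integrable (?\<nu> \<Otimes>\<^sub>M ball_measure) (\<lambda>(F, x). g (sgn (blinfun_apply (proj F) x)))"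
    by (rule integrable_const_bound[of _ B]) (use B in auto)
  then have "(LINT F|?\<nu>. LINT x|ball_measure. g (sgn (blinfun_apply (proj F) x))) =
      (LINT p|(?\<nu> \<Otimes>\<^sub>M ball_measure). (case p of (F, x) \<Rightarrow> g (sgn (blinfun_apply (proj F) x))))"
    by (rule integral_fst)
  also have "\<dots> = (LINT \<theta>|distr (?\<nu> \<Otimes>\<^sub>M ball_measure) borel (\<lambda>(F, x). sgn (blinfun_apply (proj F) x)). g \<theta>)"
    by (subst integral_distr) (simp_all add: case_prod_beta')
  finally show ?thesis by (simp add: sphere_law_average[OF E m] integral_sphere_law)
qed

lemma borel_measurable_integral_sphere_law:
  fixes g :: "'a::euclidean_space \<Rightarrow> real"
  assumes N: "sets N = sets (grassmannian_borel E m)" and [measurable]: "g \<in> borel_measurable borel"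
  shows "(\<lambda>F. LINT \<theta>|sphere_law F. g \<theta>) \<in> borel_measurable N"
proof -
  interpret ball: prob_space "ball_measure :: 'a measure" by (rule prob_space_ball_measure)
  note [measurable] = measurable_proj[OF N]
  show ?thesis unfolding integral_sphere_law[OF assms(2)] by measurable
qed

text \<open>Along converging projections the integrands over the fixed ball converge almost
  everywhere, since \<open>sgn\<close> is discontinuous only at 0 and a fixed projection of positive
  rank almost surely avoids it. Dominated convergence and compactness finish.\<close>

lemma integral_sphere_law_attains_max:
  fixes g :: "'a::euclidean_space \<Rightarrow> real"
  assumes m: "0 < m" "m \<le> DIM('a)"
    and g [measurable]: "g \<in> borel_measurable borel" and B: "\<And>x. \<bar>g x\<bar> \<le> B"
    and cont: "continuous_on (sphere 0 1) g"
  obtains E0 where "E0 \<in> grassmannian UNIV m"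
    "\<And>E. E \<in> grassmannian UNIV m \<Longrightarrow> (LINT \<theta>|sphere_law E. g \<theta>) \<le> (LINT \<theta>|sphere_law E0. g \<theta>)"
proof -
  let ?X = "proj ` grassmannian (UNIV :: 'a set) m"
  let ?Q = "\<lambda>P :: 'a \<Rightarrow>\<^sub>L 'a. LINT x|ball_measure. g (sgn (blinfun_apply P x))"
  interpret ball: prob_space "ball_measure :: 'a measure" by (rule prob_space_ball_measure)
  have "continuous_on ?X ?Q"
  proof (rule continuous_on_sequentiallyI)
    fix u P assume P: "\<forall>n. u n \<in> ?X" "P \<in> ?X" and lim: "u \<longlonglongrightarrow> P"
    obtain F where F: "F \<in> grassmannian UNIV m" "P = proj F" using P by auto
    show "(\<lambda>n. ?Q (u n)) \<longlonglongrightarrow> ?Q P"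
    proof (rule integral_dominated_convergence[where w = "\<lambda>_. B"])
      have "AE x in ball_measure. blinfun_apply P x \<noteq> 0"
        unfolding F(2) using grassmannianD[OF F(1)] m by (intro AE_ball_measure_proj_nonzero) auto
      then show "AE x in ball_measure. (\<lambda>n. g (sgn (blinfun_apply (u n) x))) \<longlonglongrightarrow> g (sgn (blinfun_apply P x))"
      proof eventually_elim
        fix x assume nz: "blinfun_apply P x \<noteq> 0"
        have l: "(\<lambda>n. blinfun_apply (u n) x) \<longlonglongrightarrow> blinfun_apply P x"
          by (intro tendsto_intros lim)
        have "(\<lambda>n. sgn (blinfun_apply (u n) x)) \<longlonglongrightarrow> sgn (blinfun_apply P x)"
          by (rule tendsto_sgn[OF l nz])
        \<comment> \<open>Continuity of \<open>g\<close> is known only on the sphere, so the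
          approximating directions must eventually lie there.\<close>
        moreover have "\<forall>\<^sub>F n in sequentially. sgn (blinfun_apply (u n) x) \<in> sphere 0 1"
          using tendsto_imp_eventually_ne[OF l nz] by eventually_elim (simp add: norm_sgn)
        ultimately show "(\<lambda>n. g (sgn (blinfun_apply (u n) x))) \<longlonglongrightarrow> g (sgn (blinfun_apply P x))"
          using nz by (intro continuous_on_tendsto_compose[OF cont]) (auto simp: norm_sgn)
      qed
    qed (use B in auto)
  qed
  moreover have "?X \<noteq> {}" using grassmannian_nonempty[of "UNIV :: 'a set" m] m by simp
  moreover have "compact ?X" by (rule compact_proj_grassmannian[OF subspace_UNIV])
  ultimately obtain P where P: "P \<in> ?X" "\<And>Q. Q \<in> ?X \<Longrightarrow> ?Q Q \<le> ?Q P"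
    using continuous_attains_sup[of ?X ?Q] by auto
  then obtain E0 where "E0 \<in> grassmannian UNIV m" "P = proj E0" by auto
  with P(2) show ?thesis using that[of E0] by (auto simp: integral_sphere_law)
qed

section \<open>Star bodies and sections\<close>

text \<open>Compactness makes the \<open>GREATEST\<close> an attained maximum. The segment condition
  makes the section by the line convex, so everything between 0 and the farthest point belongs to
  \<open>K\<close>.\<close>

lemma
  fixes K :: "'a::euclidean_space set"
  assumes K: "star_shaped_at_0 K" and u: "u \<noteq> 0"
  shows radial_function_pos: "0 < radial_function K u"
    and mem_star_shaped_iff: "0 < t \<Longrightarrow> t *\<^sub>R u \<in> K \<longleftrightarrow> t \<le> radial_function K u"
proof -
  have cpt: "compact K" and int: "0 \<in> interior K" using K by (auto simp: star_shaped_at_0_def)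
  obtain e where e: "0 < e" "ball 0 e \<subseteq> K" using int by (auto simp: mem_interior)
  \<comment> \<open>Half the inner radius along \<open>u\<close>. Cutting off the parameters below
    it replaces the non-closed condition t > 0 by a closed one without losing the maximum.\<close>
  let ?d = "e / (2 * norm u)"
  have d: "0 < ?d" "?d *\<^sub>R u \<in> K" using e u by auto
  let ?S = "{?d..} \<inter> (\<lambda>t. t *\<^sub>R u) -` K"
  have "closed ((\<lambda>t. t *\<^sub>R u) -` K)"
    by (intro closed_vimage compact_imp_closed[OF cpt] continuous_intros)
  then have "closed ?S" by (intro closed_Int) simp_all
  moreover have "bounded ?S"
  proof -
    obtain B where B: "\<And>x. x \<in> K \<Longrightarrow> norm x \<le> B" using compact_imp_bounded[OF cpt] by (auto simp: bounded_iff)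
    show ?thesis
    proof (rule boundedI)
      fix t assume "t \<in> ?S"
      then have "\<bar>t\<bar> * norm u \<le> B" using B[of "t *\<^sub>R u"] by simp
      then show "norm t \<le> B / norm u" using u by (simp add: field_simps)
    qed
  qed
  ultimately have "compact ?S" by (simp add: compact_eq_bounded_closed)
  moreover have "?d \<in> ?S" using d by simp
  ultimately obtain m where m: "m \<in> ?S" "\<And>t. t \<in> ?S \<Longrightarrow> t \<le> m"
    using compact_attains_sup[of ?S] by blast
  have m0: "0 < m" "m *\<^sub>R u \<in> K" using m(1) d by auto
  have le: "t \<le> m" if "0 < t" "t *\<^sub>R u \<in> K" for t
    using that m m0 by (cases "?d \<le> t") auto
  have r: "radial_function K u = m"
    unfolding radial_function_def using m0 le by (intro Greatest_equality) auto
  show "0 < radial_function K u" using r m0 by simp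
  assume t: "0 < t"
  obtain a b where ab: "K \<inter> span {u} = closed_segment a b"
    using K u unfolding star_shaped_at_0_def by blast
  have "t *\<^sub>R u \<in> K" if "t \<le> m"
  proof -
    have "convex (K \<inter> span {u})" unfolding ab by (rule convex_closed_segment)
    moreover have "0 \<in> K \<inter> span {u}" using int interior_subset span_zero by blast
    moreover have "m *\<^sub>R u \<in> K \<inter> span {u}" using m0 by (simp add: span_base span_scale)
    ultimately have "(1 - t / m) *\<^sub>R 0 + (t / m) *\<^sub>R (m *\<^sub>R u) \<in> K \<inter> span {u}"
      using t that m0 by (intro convexD) auto
    then show ?thesis using m0 by simp
  qed
  then show "t *\<^sub>R u \<in> K \<longleftrightarrow> t \<le> radial_function K u" using le t r by auto
qed

text \<open>Continuity is assumed on the sphere only; a constant outside yields a globally Borel,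
  bounded function. The constant is a parameter because radial functions must stay positive (value
  1), while test functions take 0.\<close>

definition sphere_ext :: "real \<Rightarrow> ('a::euclidean_space \<Rightarrow> real) \<Rightarrow> 'a \<Rightarrow> real" where
  "sphere_ext c g \<theta> = (if \<theta> \<in> sphere 0 1 then g \<theta> else c)"

lemma borel_measurable_sphere_ext:
  "continuous_on (sphere 0 1) g \<Longrightarrow> sphere_ext c g \<in> borel_measurable borel"
  unfolding sphere_ext_def[abs_def] by (intro borel_measurable_continuous_on_if) auto

lemma continuous_on_sphere_ext:
  "continuous_on (sphere 0 1) g \<Longrightarrow> continuous_on (sphere 0 1) (sphere_ext c g)"
  by (rule continuous_on_eq[of _ g]) (auto simp: sphere_ext_def)

lemma bounded_sphere_ext:
  fixes g :: "'a::euclidean_space \<Rightarrow> real"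
  assumes "continuous_on (sphere 0 1) g"
  obtains B where "0 < B" "\<And>x. \<bar>sphere_ext c g x\<bar> \<le> B"
proof -
  have "compact (g ` sphere 0 1)" by (intro compact_continuous_image assms compact_sphere)
  then have "bounded (g ` sphere 0 1)" by (rule compact_imp_bounded)
  then obtain B where "\<forall>y\<in>g ` sphere 0 1. norm y \<le> B" unfolding bounded_iff by blast
  then have "\<And>x. x \<in> sphere 0 1 \<Longrightarrow> \<bar>g x\<bar> \<le> B" by simp
  then show ?thesis
    using that[of "max 1 (max B \<bar>c\<bar>)"] by (force simp: sphere_ext_def)
qed

lemma space_sphere_measure: "space (sphere_measure E) = E \<inter> sphere 0 1"
  by (simp add: sphere_measure_def space_restrict_space)

lemma integral_sphere_measure_ext:
  fixes E :: "'a::euclidean_space set"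
  assumes "subspace E" "0 < dim E" "continuous_on (sphere 0 1) g"
  shows "(LINT \<theta>|sphere_measure E. g \<theta>) = dim E * unit_ball_vol (dim E) * (LINT \<theta>|sphere_law E. sphere_ext c g \<theta>)"
proof -
  have "(LINT \<theta>|sphere_measure E. g \<theta>) = (LINT \<theta>|sphere_measure E. sphere_ext c g \<theta>)"
    by (intro Bochner_Integration.integral_cong) (auto simp: space_sphere_measure sphere_ext_def)
  then show ?thesis
    using integral_sphere_measure[OF assms(1,2) borel_measurable_sphere_ext[OF assms(3)]] by simp
qed

lemma integrable_sphere_law:
  fixes g :: "'a::euclidean_space \<Rightarrow> real"
  assumes "g \<in> borel_measurable borel" "\<And>x. \<bar>g x\<bar> \<le> B"
  shows "integrable (sphere_law F) g"
proof -
  interpret prob_space "sphere_law F" by (rule prob_space_sphere_law)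
  show ?thesis using assms by (intro integrable_const_bound[of _ B]) auto
qed

text \<open>Off the unit sphere \<^term>\<open>radial K\<close> takes the junk value 1, which makes it a positive
  bounded Borel function on the whole space.\<close>
abbreviation radial :: "'a::euclidean_space set \<Rightarrow> 'a \<Rightarrow> real" where
  "radial K \<equiv> sphere_ext 1 (radial_function K)"

context
  fixes K :: "'a::euclidean_space set"
  assumes K: "star_body K"
begin

lemma radial_borel_measurable [measurable]: "radial K \<in> borel_measurable borel"
  using K by (intro borel_measurable_sphere_ext) (simp add: star_body_def)

lemma radial_pos: "0 < radial K \<theta>"
proof (cases "\<theta> \<in> sphere 0 1")
  case True
  then have "\<theta> \<noteq> 0" by auto
  then show ?thesis using K radial_function_pos[of K \<theta>] True by (simp add: sphere_ext_def star_body_def)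
qed (simp add: sphere_ext_def)

lemma radial_power_bounded:
  obtains B where "\<And>x. \<bar>radial K x ^ m\<bar> \<le> B"
proof -
  have "continuous_on (sphere 0 1) (radial_function K)" using K by (simp add: star_body_def)
  then obtain B where B: "0 < B" "\<And>x. \<bar>radial K x\<bar> \<le> B" by (rule bounded_sphere_ext[where c = 1]) blast
  have "\<bar>radial K x ^ m\<bar> \<le> B ^ m" for x
    unfolding power_abs using B by (intro power_mono) auto
  then show ?thesis using that by blast
qed

lemma continuous_on_radial_power: "continuous_on (sphere 0 1) (\<lambda>\<theta>. radial K \<theta> ^ m)"
  using K by (intro continuous_intros continuous_on_sphere_ext) (simp add: star_body_def)

lemma integrable_radial_power: "integrable (sphere_law F) (\<lambda>\<theta>. radial K \<theta> ^ m)"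
proof -
  obtain B where "\<And>x. \<bar>radial K x ^ m\<bar> \<le> B" by (rule radial_power_bounded[where m = m]) blast
  then show ?thesis by (intro integrable_sphere_law) measurable
qed

lemma mem_star_body_iff:
  assumes "x \<noteq> 0"
  shows "x \<in> K \<longleftrightarrow> norm x \<le> radial K (sgn x)"
proof -
  have "star_shaped_at_0 K" using K by (simp add: star_body_def)
  then have "norm x *\<^sub>R sgn x \<in> K \<longleftrightarrow> norm x \<le> radial_function K (sgn x)"
    using assms by (intro mem_star_shaped_iff) (auto simp: sgn_zero_iff)
  then show ?thesis using assms by (simp add: sphere_ext_def norm_sgn sgn_div_norm)
qed

lemma measure_star_body_section:
  assumes F: "subspace F" "0 < dim F"
  shows "measure (subspace_lborel F) (K \<inter> F) =
    unit_ball_vol (dim F) * (LINT \<theta>|sphere_law F. radial K \<theta> ^ dim F)"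
proof -
  \<comment> \<open>\<open>?h\<close> depends only on the direction, and since
    \<open>sgn 0 = 0\<close> is off the sphere its value at the origin is 1, so it is positive
    everywhere, as \<open>emeasure_polar\<close> demands.\<close>
  let ?L = "subspace_lborel F" and ?h = "\<lambda>x. radial K (sgn x)"
  have h: "0 < ?h x" for x by (rule radial_pos)
  have "closed F" "closed K"
    using closed_subspace[OF F(1)] K by (auto simp: star_body_def star_shaped_at_0_def compact_imp_closed)
  then have KF: "K \<inter> F \<in> sets borel" by (intro borel_closed closed_Int)
  have "emeasure ?L (K \<inter> F) = emeasure ?L {x. x \<noteq> 0 \<and> norm x \<le> ?h x}"
  proof (rule emeasure_eq_AE)
    show "AE x in ?L. x \<in> K \<inter> F \<longleftrightarrow> x \<in> {x. x \<noteq> 0 \<and> norm x \<le> ?h x}"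
      using AE_subspace_lborel[OF F(1)] AE_subspace_lborel_nonzero[OF F]
      by eventually_elim (simp add: mem_star_body_iff)
    show "{x. x \<noteq> 0 \<and> norm x \<le> ?h x} \<in> sets ?L" by measurable
  qed (use KF in simp)
  also have "\<dots> = (\<integral>\<^sup>+x. indicator (cball 0 1 - {0}) x * ennreal (?h x ^ dim F) \<partial>?L)"
    by (intro emeasure_polar F h) (measurable, simp add: sgn_scaleR)
  also have "\<dots> = (\<integral>\<^sup>+x. indicator (F \<inter> cball 0 1 - {0}) x * ennreal (?h x ^ dim F) \<partial>?L)"
    using AE_subspace_lborel[OF F(1)] by (intro nn_integral_cong_AE) (auto simp: indicator_def)
  also have "\<dots> = ennreal (unit_ball_vol (dim F)) * (\<integral>\<^sup>+\<theta>. ennreal (radial K \<theta> ^ dim F) \<partial>sphere_law F)"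
    by (rule nn_integral_sphere_law[OF F, symmetric]) measurable
  also have "(\<integral>\<^sup>+\<theta>. ennreal (radial K \<theta> ^ dim F) \<partial>sphere_law F) =
      ennreal (LINT \<theta>|sphere_law F. radial K \<theta> ^ dim F)"
    using radial_pos by (intro nn_integral_eq_integral integrable_radial_power) (simp add: less_imp_le)
  also have "ennreal (unit_ball_vol (dim F)) * \<dots> =
      ennreal (unit_ball_vol (dim F) * (LINT \<theta>|sphere_law F. radial K \<theta> ^ dim F))"
    using radial_pos by (intro ennreal_mult[symmetric]) (auto intro!: integral_nonneg_AE simp: less_imp_le)
  finally show ?thesis
    using radial_pos by (simp add: measure_def enn2real_ennreal integral_nonneg_AE less_imp_le)
qed

lemma measure_star_body:
  "measure lborel K = unit_ball_vol DIM('a) * (LINT \<theta>|sphere_law UNIV. radial K \<theta> ^ DIM('a))"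
  using measure_star_body_section[OF subspace_UNIV] by (simp add: subspace_lborel_UNIV)

text \<open>All sections averaged have the same dimension, so the exponent and the ball volume do
  not vary with \<open>F\<close>, and averaging sphere means over subspaces gives the sphere mean of
  \<open>E\<close>.\<close>

lemma avg_section_star_body:
  assumes E: "subspace E" and r: "r < dim E"
  shows "avg_section r E (K \<inter> E) =
    unit_ball_vol (dim E - r) * (LINT \<theta>|sphere_law E. radial K \<theta> ^ (dim E - r))"
proof -
  let ?m = "dim E - r"
  have m: "0 < ?m" "?m \<le> dim E" using r by auto
  obtain B where B: "\<And>x. \<bar>radial K x ^ ?m\<bar> \<le> B" by (rule radial_power_bounded[where m = ?m]) blast
  have "avg_section r E (K \<inter> E) =
      (LINT F|grassmannian_haar E ?m. unit_ball_vol ?m * (LINT \<theta>|sphere_law F. radial K \<theta> ^ ?m))"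
    unfolding avg_section_def
  proof (rule Bochner_Integration.integral_cong[OF refl])
    fix F assume "F \<in> space (grassmannian_haar E ?m)"
    then have "F \<in> grassmannian E ?m" by (simp add: space_grassmannian_haar[OF E m(2)])
    note F = grassmannianD[OF this]
    have "K \<inter> E \<inter> F = K \<inter> F" using F(2) by auto
    then show "measure (subspace_lborel F) (K \<inter> E \<inter> F) =
        unit_ball_vol ?m * (LINT \<theta>|sphere_law F. radial K \<theta> ^ ?m)"
      using measure_star_body_section[OF F(1)] F(3) m(1) by simp
  qed
  also have "\<dots> = unit_ball_vol ?m * (LINT F|grassmannian_haar E ?m. LINT \<theta>|sphere_law F. radial K \<theta> ^ ?m)"
    by (rule integral_mult_right_zero)
  also have "(LINT F|grassmannian_haar E ?m. LINT \<theta>|sphere_law F. radial K \<theta> ^ ?m) =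
      (LINT \<theta>|sphere_law E. radial K \<theta> ^ ?m)"
    by (rule integral_sphere_law_average[OF E m _ B]) measurable
  finally show ?thesis .
qed

text \<open>Monotonicity of power means: Jensen for the convex function t to the power n/k on the
  positive reals.\<close>

lemma integral_radial_power_le:
  assumes "0 < k" "k \<le> n"
  shows "(LINT \<theta>|sphere_law F. radial K \<theta> ^ k) \<le> (LINT \<theta>|sphere_law F. radial K \<theta> ^ n) powr (real k / real n)"
proof -
  interpret prob_space "sphere_law F" by (rule prob_space_sphere_law)
  let ?I = "LINT \<theta>|sphere_law F. radial K \<theta> ^ k"
  have eq: "(radial K \<theta> ^ k) powr (real n / real k) = radial K \<theta> ^ n" for \<theta>
    using assms radial_pos[of \<theta>] by (simp add: powr_realpow[symmetric] powr_powr)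
  have I: "0 \<le> ?I" using radial_pos by (auto intro!: integral_nonneg_AE simp: less_imp_le)
  have "?I powr (real n / real k) \<le> (LINT \<theta>|sphere_law F. (radial K \<theta> ^ k) powr (real n / real k))"
    using assms radial_pos
    by (intro jensens_inequality[where I = "{0<..}" and a = 0] powr_convex integrable_radial_power)
      (auto simp: eq integrable_radial_power)
  then have "?I powr (real n / real k) \<le> (LINT \<theta>|sphere_law F. radial K \<theta> ^ n)" by (simp add: eq)
  then have "(?I powr (real n / real k)) powr (real k / real n) \<le>
      (LINT \<theta>|sphere_law F. radial K \<theta> ^ n) powr (real k / real n)"
    by (intro powr_mono2) auto
  then show ?thesis using I assms by (simp add: powr_powr)
qed

end

section \<open>The inequality for a single intersection body containing K\<close>

lemma radial_mono:
  assumes "star_body K" "star_body D" "K \<subseteq> D"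
  shows "radial K \<theta> \<le> radial D \<theta>"
proof (cases "\<theta> \<in> sphere 0 1")
  case True
  then have "\<theta> \<noteq> 0" by auto
  have "star_shaped_at_0 K" "star_shaped_at_0 D" using assms by (auto simp: star_body_def)
  then have "radial_function K \<theta> \<le> radial_function D \<theta>"
    using mem_star_shaped_iff[of K \<theta> "radial_function K \<theta>"] mem_star_shaped_iff[of D \<theta> "radial_function K \<theta>"]
      radial_function_pos[of K \<theta>] \<open>\<theta> \<noteq> 0\<close> assms(3) by auto
  then show ?thesis using True by (simp add: sphere_ext_def)
qed (simp add: sphere_ext_def)

text \<open>Stated with an arbitrary bound \<open>M\<close> on the sphere means, so that neither a
  maximiser nor the section functional enters.\<close>

lemma radial_le_of_gen_intersection_body:
  fixes K D :: "'a::euclidean_space set"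
  assumes K: "star_body K" and D: "D \<in> gen_intersection_bodies k" "K \<subseteq> D"
    and k: "0 < k" "k < DIM('a)"
    and M: "\<And>E. E \<in> grassmannian UNIV (DIM('a) - k) \<Longrightarrow> (LINT \<theta>|sphere_law E. radial K \<theta> ^ p) \<le> M"
  shows "(LINT \<theta>|sphere_law UNIV. radial K \<theta> ^ (k + p)) \<le>
    M * (measure lborel D / unit_ball_vol DIM('a)) powr (k / DIM('a))"
proof -
  let ?n = "DIM('a)" and ?q = "DIM('a) - k"
  let ?\<sigma> = "sphere_law (UNIV :: 'a set)"
  \<comment> \<open>\<open>C\<close> and \<open>c\<close> are the surface areas of the unit spheres
    in dimensions n and n-k. They occur alike in the identity for \<open>p\<close> and in the one
    for the total mass, and therefore cancel.\<close>
  define C where "C = real ?n * unit_ball_vol ?n"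
  define c where "c = real ?q * unit_ball_vol ?q"
  have q: "0 < ?q" "?q \<le> ?n" using k by auto
  have pos: "0 < C" "0 < c" using q(1) by (auto simp: C_def c_def)
  have sD: "star_body D" using D by (simp add: gen_intersection_bodies_def)
  obtain \<mu> where \<mu>: "finite_measure \<mu>" "sets \<mu> = sets (grassmannian_borel UNIV ?q)"
    and radon: "\<And>g. continuous_on (sphere 0 1) g \<Longrightarrow>
      (LINT \<theta>|sphere_measure UNIV. radial_function D \<theta> ^ k * g \<theta>) = (LINT H|\<mu>. spherical_radon g H)"
    using D unfolding gen_intersection_bodies_def by blast
  interpret \<mu>: finite_measure \<mu> by (rule \<mu>(1))
  have sp: "space \<mu> = grassmannian UNIV ?q" using sets_eq_imp_space_eq[OF \<mu>(2)] by simp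
  have gr: "subspace H" "dim H = ?q" if "H \<in> space \<mu>" for H
    using grassmannianD that by (auto simp: sp)
  \<comment> \<open>Used for two exponents: \<open>j = p\<close> brings in the sections of
    \<open>K\<close>, and \<open>j = 0\<close> tests with the constant 1 and so yields the total
    mass of the representing measure.\<close>
  have key: "C * (LINT \<theta>|?\<sigma>. radial D \<theta> ^ k * radial K \<theta> ^ j) =
      (LINT H|\<mu>. c * (LINT \<theta>|sphere_law H. radial K \<theta> ^ j))" for j
  proof -
    note cont = continuous_on_radial_power[OF K, of j]
    have contD: "continuous_on (sphere 0 1) (\<lambda>\<theta>. radial_function D \<theta> ^ k * radial K \<theta> ^ j)"
      using sD by (intro continuous_intros cont) (simp add: star_body_def)
    have "(LINT \<theta>|sphere_measure UNIV. radial_function D \<theta> ^ k * radial K \<theta> ^ j) =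
        C * (LINT \<theta>|?\<sigma>. sphere_ext 1 (\<lambda>\<theta>. radial_function D \<theta> ^ k * radial K \<theta> ^ j) \<theta>)"
      using integral_sphere_measure_ext[OF subspace_UNIV _ contD, of 1] by (simp add: C_def)
    also have "sphere_ext 1 (\<lambda>\<theta>. radial_function D \<theta> ^ k * radial K \<theta> ^ j) =
        (\<lambda>\<theta>. radial D \<theta> ^ k * radial K \<theta> ^ j)"
      by (auto simp: sphere_ext_def fun_eq_iff)
    finally have "C * (LINT \<theta>|?\<sigma>. radial D \<theta> ^ k * radial K \<theta> ^ j) =
        (LINT H|\<mu>. spherical_radon (\<lambda>\<theta>. radial K \<theta> ^ j) H)"
      using radon[OF cont] by simp
    also have "\<dots> = (LINT H|\<mu>. c * (LINT \<theta>|sphere_law H. radial K \<theta> ^ j))"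
    proof (rule Bochner_Integration.integral_cong[OF refl])
      fix H assume H: "H \<in> space \<mu>"
      have "(\<lambda>\<theta>. radial K \<theta> ^ j) \<in> borel_measurable borel"
        using radial_borel_measurable[OF K] by measurable
      then show "spherical_radon (\<lambda>\<theta>. radial K \<theta> ^ j) H = c * (LINT \<theta>|sphere_law H. radial K \<theta> ^ j)"
        using integral_sphere_measure[OF gr(1)[OF H]] gr(2)[OF H] q(1)
        by (simp add: spherical_radon_def c_def)
    qed
    finally show ?thesis .
  qed
  have mass: "C * (LINT \<theta>|?\<sigma>. radial D \<theta> ^ k) = c * measure \<mu> (space \<mu>)"
  proof -
    have "(LINT \<theta>|sphere_law H. radial K \<theta> ^ 0) = 1" for H
      using prob_space.prob_space[OF prob_space_sphere_law, of H] by simp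
    then show ?thesis using key[of 0] by (simp add: mult.commute)
  qed
  have "(LINT H|\<mu>. c * (LINT \<theta>|sphere_law H. radial K \<theta> ^ p)) \<le> (LINT H|\<mu>. c * M)"
  proof (rule integral_mono)
    have "(\<lambda>\<theta>. radial K \<theta> ^ p) \<in> borel_measurable borel"
      using radial_borel_measurable[OF K] by measurable
    then have m: "(\<lambda>H. LINT \<theta>|sphere_law H. radial K \<theta> ^ p) \<in> borel_measurable \<mu>"
      by (rule borel_measurable_integral_sphere_law[OF \<mu>(2)])
    have "\<bar>LINT \<theta>|sphere_law H. radial K \<theta> ^ p\<bar> \<le> M" if "H \<in> space \<mu>" for H
    proof -
      have "0 \<le> (LINT \<theta>|sphere_law H. radial K \<theta> ^ p)"
        using radial_pos[OF K] by (auto intro!: integral_nonneg_AE simp: less_imp_le)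
      then show ?thesis using M[of H] that sp by simp
    qed
    then have "integrable \<mu> (\<lambda>H. LINT \<theta>|sphere_law H. radial K \<theta> ^ p)"
      by (intro \<mu>.integrable_const_bound[of _ M] m AE_I2) auto
    then show "integrable \<mu> (\<lambda>H. c * (LINT \<theta>|sphere_law H. radial K \<theta> ^ p))" by simp
    show "c * (LINT \<theta>|sphere_law H. radial K \<theta> ^ p) \<le> c * M" if "H \<in> space \<mu>" for H
      using M[of H] that sp pos by simp
  qed simp
  also have "(LINT H|\<mu>. c * M) = C * (M * (LINT \<theta>|?\<sigma>. radial D \<theta> ^ k))"
    using mass by (simp add: mult_ac)
  finally have "C * (LINT \<theta>|?\<sigma>. radial D \<theta> ^ k * radial K \<theta> ^ p) \<le> C * (M * (LINT \<theta>|?\<sigma>. radial D \<theta> ^ k))"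
    unfolding key .
  then have 1: "(LINT \<theta>|?\<sigma>. radial D \<theta> ^ k * radial K \<theta> ^ p) \<le> M * (LINT \<theta>|?\<sigma>. radial D \<theta> ^ k)"
    using pos by simp
  have 2: "(LINT \<theta>|?\<sigma>. radial K \<theta> ^ (k + p)) \<le> (LINT \<theta>|?\<sigma>. radial D \<theta> ^ k * radial K \<theta> ^ p)"
  proof (rule integral_mono)
    show "integrable ?\<sigma> (\<lambda>\<theta>. radial K \<theta> ^ (k + p))" by (rule integrable_radial_power[OF K])
    obtain A where A: "\<And>x. \<bar>radial D x ^ k\<bar> \<le> A" by (rule radial_power_bounded[OF sD, where m = k]) blast
    obtain B where B: "\<And>x. \<bar>radial K x ^ p\<bar> \<le> B" by (rule radial_power_bounded[OF K, where m = p]) blast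
    note [measurable] = radial_borel_measurable[OF K] radial_borel_measurable[OF sD]
    show "integrable ?\<sigma> (\<lambda>\<theta>. radial D \<theta> ^ k * radial K \<theta> ^ p)"
    proof (rule integrable_sphere_law)
      show "\<bar>radial D x ^ k * radial K x ^ p\<bar> \<le> A * B" for x
        unfolding abs_mult using A[of x] B[of x] by (intro mult_mono) (auto intro: order_trans[OF abs_ge_zero])
    qed measurable
    show "radial K \<theta> ^ (k + p) \<le> radial D \<theta> ^ k * radial K \<theta> ^ p" for \<theta>
      unfolding power_add using radial_mono[OF K sD D(2), of \<theta>] radial_pos[OF K, of \<theta>]
      by (intro mult_right_mono power_mono) auto
  qed
  have M0: "0 \<le> M"
  proof -
    obtain E :: "'a set" where E: "E \<in> grassmannian UNIV ?q"
      using grassmannian_nonempty[of "UNIV :: 'a set" ?q] q by auto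
    have "0 \<le> (LINT \<theta>|sphere_law E. radial K \<theta> ^ p)"
      using radial_pos[OF K] by (auto intro!: integral_nonneg_AE simp: less_imp_le)
    then show ?thesis using M[OF E] by simp
  qed
  have "(LINT \<theta>|?\<sigma>. radial D \<theta> ^ k) \<le> (LINT \<theta>|?\<sigma>. radial D \<theta> ^ ?n) powr (k / ?n)"
    using k by (intro integral_radial_power_le[OF sD]) auto
  also have "(LINT \<theta>|?\<sigma>. radial D \<theta> ^ ?n) = measure lborel D / unit_ball_vol ?n"
    using measure_star_body[OF sD] by simp
  finally have 3: "M * (LINT \<theta>|?\<sigma>. radial D \<theta> ^ k) \<le> M * (measure lborel D / unit_ball_vol ?n) powr (k / ?n)"
    using M0 by (rule mult_left_mono)
  from 2 1 3 show ?thesis by linarith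
qed

section \<open>Balls as generalized intersection bodies\<close>

lemma star_body_cball:
  assumes R: "0 < R"
  shows "star_body (cball (0 :: 'a::euclidean_space) R)"
    and "\<theta> \<in> sphere (0 :: 'a) 1 \<Longrightarrow> radial_function (cball 0 R) \<theta> = R"
proof -
  show rad: "radial_function (cball 0 R) \<theta> = R" if "\<theta> \<in> sphere (0 :: 'a) 1" for \<theta>
    unfolding radial_function_def using that R by (intro Greatest_equality) auto
  have "\<exists>a b. cball 0 R \<inter> span {u} = closed_segment a b" if u: "u \<noteq> 0" for u :: 'a
  proof (intro exI equalityI subsetI)
    let ?b = "(R / norm u) *\<^sub>R u"
    fix x assume x: "x \<in> cball 0 R \<inter> span {u}"
    then obtain c where "x = c *\<^sub>R u" by (auto simp: span_singleton)
    with x have c: "x = c *\<^sub>R u" "\<bar>c\<bar> * norm u \<le> R" by auto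
    let ?t = "(1 + c * norm u / R) / 2"
    have "\<bar>c * norm u / R\<bar> \<le> 1" using c(2) R by (simp add: abs_mult)
    then have "- 1 \<le> c * norm u / R" "c * norm u / R \<le> 1" by linarith+
    then have "0 \<le> ?t" "?t \<le> 1" by simp_all
    moreover have "x = (1 - ?t) *\<^sub>R (- ?b) + ?t *\<^sub>R ?b"
    proof -
      have "(1 - ?t) *\<^sub>R (- ?b) + ?t *\<^sub>R ?b = ((2 * ?t - 1) * (R / norm u)) *\<^sub>R u"
        by (simp add: algebra_simps flip: scaleR_add_left scaleR_diff_left)
      also have "(2 * ?t - 1) * (R / norm u) = c" using R u by (simp add: field_simps)
      finally show ?thesis using c by simp
    qed
    ultimately show "x \<in> closed_segment (- ?b) ?b" unfolding in_segment by blast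
  next
    let ?b = "(R / norm u) *\<^sub>R u"
    have "- ?b \<in> cball 0 R \<inter> span {u}" "?b \<in> cball 0 R \<inter> span {u}"
      using R u by (auto simp: span_neg span_scale span_base)
    moreover have "convex (cball 0 R \<inter> span {u})"
      by (intro convex_Int convex_cball subspace_imp_convex subspace_span)
    ultimately have "closed_segment (- ?b) ?b \<subseteq> cball 0 R \<inter> span {u}"
      by (rule closed_segment_subset)
    then show "x \<in> cball 0 R \<inter> span {u}" if "x \<in> closed_segment (- ?b) ?b" for x using that by blast
  qed
  moreover have "continuous_on (sphere 0 1) (radial_function (cball (0 :: 'a) R))"
    by (rule continuous_on_eq[of _ "\<lambda>_. R"]) (auto simp: rad)
  ultimately show "star_body (cball (0 :: 'a) R)"
    using R by (auto simp: star_body_def star_shaped_at_0_def)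
qed

text \<open>Ensures that the infimum in \<open>outer_volume_ratio_dist\<close> is over a nonempty
  set. A multiple of Haar measure represents the ball, because averaging over subspaces reproduces
  the mean over the whole sphere.\<close>

lemma cball_gen_intersection_body:
  assumes R: "0 < R" and k: "k < DIM('a)"
  shows "cball (0 :: 'a::euclidean_space) R \<in> gen_intersection_bodies k"
proof -
  let ?n = "DIM('a)" and ?q = "DIM('a) - k"
  let ?\<nu> = "grassmannian_haar (UNIV :: 'a set) ?q"
  define C where "C = real ?n * unit_ball_vol ?n"
  define c where "c = real ?q * unit_ball_vol ?q"
  have q: "0 < ?q" "?q \<le> dim (UNIV :: 'a set)" using k by auto
  have pos: "0 < C" "0 < c" using q(1) by (auto simp: C_def c_def)
  \<comment> \<open>The total mass is forced by testing with the constant 1: \<open>R ^ k\<close>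
    times the area of the big sphere must equal the mass times the area \<open>c\<close> of the
    small one.\<close>
  let ?\<mu> = "density ?\<nu> (\<lambda>_. ennreal (R ^ k * C / c))"
  interpret \<nu>: prob_space ?\<nu> by (rule prob_space_grassmannian_haar[OF subspace_UNIV q(2)])
  note sets = sets_grassmannian_haar[OF subspace_UNIV q(2)] and sp = space_grassmannian_haar[OF subspace_UNIV q(2)]
  have "finite_measure ?\<mu>"
    by (rule finite_measureI) (simp add: emeasure_density_const ennreal_mult_eq_top_iff)
  moreover have "(LINT \<theta>|sphere_measure UNIV. radial_function (cball 0 R) \<theta> ^ k * g \<theta>) = (LINT H|?\<mu>. spherical_radon g H)"
    if g: "continuous_on (sphere 0 1) g" for g :: "'a \<Rightarrow> real"
  proof -
    note g_meas = borel_measurable_sphere_ext[OF g, of 0]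
    obtain B where B: "\<And>x. \<bar>sphere_ext 0 g x\<bar> \<le> B" by (rule bounded_sphere_ext[OF g, where c = 0]) blast
    have radon: "spherical_radon g H = c * (LINT \<theta>|sphere_law H. sphere_ext 0 g \<theta>)" if "H \<in> space ?\<mu>" for H
    proof -
      have "H \<in> grassmannian UNIV ?q" using that by (simp add: sp)
      note H = grassmannianD[OF this]
      show ?thesis
        using integral_sphere_measure_ext[OF H(1) _ g, of 0] H(3) q(1)
        by (simp add: spherical_radon_def c_def)
    qed
    have "(LINT H|?\<mu>. spherical_radon g H) = (LINT H|?\<mu>. c * (LINT \<theta>|sphere_law H. sphere_ext 0 g \<theta>))"
      by (rule Bochner_Integration.integral_cong[OF refl radon])
    also have "\<dots> = (LINT H|?\<nu>. (R ^ k * C / c) *\<^sub>R (c * (LINT \<theta>|sphere_law H. sphere_ext 0 g \<theta>)))"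
      using R pos borel_measurable_integral_sphere_law[OF sets g_meas]
      by (intro integral_density) auto
    also have "\<dots> = R ^ k * C * (LINT H|?\<nu>. LINT \<theta>|sphere_law H. sphere_ext 0 g \<theta>)"
      using pos by simp
    also have "(LINT H|?\<nu>. LINT \<theta>|sphere_law H. sphere_ext 0 g \<theta>) = (LINT \<theta>|sphere_law UNIV. sphere_ext 0 g \<theta>)"
      by (rule integral_sphere_law_average[OF subspace_UNIV q g_meas B])
    also have "R ^ k * C * \<dots> = R ^ k * (LINT \<theta>|sphere_measure UNIV. g \<theta>)"
      using integral_sphere_measure_ext[OF subspace_UNIV _ g, of 0] by (simp add: C_def)
    also have "\<dots> = (LINT \<theta>|sphere_measure UNIV. R ^ k * g \<theta>)" by simp
    also have "\<dots> = (LINT \<theta>|sphere_measure UNIV. radial_function (cball 0 R) \<theta> ^ k * g \<theta>)"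
      by (intro Bochner_Integration.integral_cong refl) (simp add: space_sphere_measure star_body_cball(2)[OF R])
    finally show ?thesis ..
  qed
  moreover have "sets ?\<mu> = sets (grassmannian_borel UNIV ?q)" by (simp add: sets)
  moreover have "origin_symmetric (cball (0 :: 'a) R)"
    by (auto simp: origin_symmetric_def minus_image_eq_vimage)
  ultimately show ?thesis
    unfolding gen_intersection_bodies_def using star_body_cball(1)[OF R] by blast
qed

text \<open>The maximum is rendered by a maximiser, so that its existence is part of the
  conclusion.\<close>

theorem theorem1p5:
  fixes K :: "(real ^ 'n) set" and n k r :: nat
  assumes "n = CARD('n)"
    and "1 \<le> k" and "k < n - 2"
    and "1 \<le> r" and "r < n - k"
    and "star_body K" and "origin_symmetric K"
  shows "\<exists>E\<^sub>0 \<in> grassmannian UNIV (n - k).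
           (\<forall>E \<in> grassmannian UNIV (n - k).
              avg_section r E (K \<inter> E) \<le> avg_section r E\<^sub>0 (K \<inter> E\<^sub>0)) \<and>
           avg_section r UNIV K
             \<le> unit_ball_vol (n - r) /
                  (unit_ball_vol (n - k - r) * unit_ball_vol n powr (k / n))
                * outer_volume_ratio_dist K (gen_intersection_bodies k) ^ k
                * measure lborel K powr (k / n)
                * avg_section r E\<^sub>0 (K \<inter> E\<^sub>0)"
proof -
  note K = \<open>star_body K\<close>
  have n: "n = DIM(real ^ 'n)" using assms(1) by simp
  let ?p = "n - k - r"
  \<comment> \<open>The split of \<open>n - r\<close> matters: \<open>k\<close> factors of the
    radial function are compared with D, and the remaining \<open>?p\<close> are the exponent for
    the sections, positive because \<open>r < n - k\<close>.\<close>
  have k: "0 < k" "k < n" and q: "0 < n - k" "n - k \<le> DIM(real ^ 'n)" and nr: "n - r = k + ?p"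
    using assms n by auto
  obtain B where B: "\<And>x. \<bar>radial K x ^ ?p\<bar> \<le> B" by (rule radial_power_bounded[OF K, where m = ?p]) blast
  have "(\<lambda>\<theta>. radial K \<theta> ^ ?p) \<in> borel_measurable borel" using radial_borel_measurable[OF K] by measurable
  then obtain E0 where E0: "E0 \<in> grassmannian UNIV (n - k)"
    "\<And>E. E \<in> grassmannian UNIV (n - k) \<Longrightarrow>
      (LINT \<theta>|sphere_law E. radial K \<theta> ^ ?p) \<le> (LINT \<theta>|sphere_law E0. radial K \<theta> ^ ?p)"
    by (rule integral_sphere_law_attains_max[OF q _ B continuous_on_radial_power[OF K]]) blast
  define M where "M = (LINT \<theta>|sphere_law E0. radial K \<theta> ^ ?p)"
  have avg: "avg_section r E (K \<inter> E) = unit_ball_vol ?p * (LINT \<theta>|sphere_law E. radial K \<theta> ^ ?p)"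
    if "E \<in> grassmannian UNIV (n - k)" for E
    using avg_section_star_body[OF K grassmannianD(1)[OF that]] grassmannianD(3)[OF that] assms by simp
  have M0: "0 \<le> M" unfolding M_def
    using radial_pos[OF K] by (auto intro!: integral_nonneg_AE simp: less_imp_le)
  have avgU: "avg_section r UNIV K = unit_ball_vol (n - r) * (LINT \<theta>|sphere_law UNIV. radial K \<theta> ^ (k + ?p))"
    using avg_section_star_body[OF K subspace_UNIV, of r] assms by (simp add: nr)
  have Kpos: "0 < measure lborel K"
  proof -
    obtain e where e: "0 < e" "cball 0 e \<subseteq> K"
      using K by (auto simp: star_body_def star_shaped_at_0_def mem_interior_cball)
    have "compact K" using K by (simp add: star_body_def star_shaped_at_0_def)
    have "0 < measure lborel (cball (0 :: real ^ 'n) e)"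
      using e content_cball[of e "0 :: real ^ 'n"] by (simp add: less_imp_le)
    also have "\<dots> \<le> measure lborel K"
      using e \<open>compact K\<close> by (intro measure_mono_fmeasurable fmeasurable_compact) auto
    finally show ?thesis .
  qed
  \<comment> \<open>Everything in the claimed bound except the distance. The last factor is the
    maximal section average, and its ball volume cancels the one in the denominator.\<close>
  define A where "A = unit_ball_vol (n - r) / (unit_ball_vol ?p * unit_ball_vol n powr (k / n))
    * measure lborel K powr (k / n) * (unit_ball_vol ?p * M)"
  define S where "S = {(measure lborel D / measure lborel K) powr (1 / DIM(real ^ 'n)) | D.
    K \<subseteq> D \<and> D \<in> gen_intersection_bodies k}"
  have le: "avg_section r UNIV K \<le> A * v ^ k" if v: "v \<in> S" for v
  proof -
    obtain D where D: "K \<subseteq> D" "D \<in> gen_intersection_bodies k"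
      "v = (measure lborel D / measure lborel K) powr (1 / n)"
      using v unfolding S_def n by blast
    have "(LINT \<theta>|sphere_law UNIV. radial K \<theta> ^ (k + ?p)) \<le>
        M * (measure lborel D / unit_ball_vol n) powr (k / n)"
      by (rule radial_le_of_gen_intersection_body[OF K D(2,1), folded n, OF k])
        (unfold M_def, rule E0(2))
    then have "avg_section r UNIV K \<le> unit_ball_vol (n - r) * (M * (measure lborel D / unit_ball_vol n) powr (k / n))"
      unfolding avgU by (intro mult_left_mono) auto
    also have "measure lborel D powr (k / n) = v ^ k * measure lborel K powr (k / n)"
    proof -
      have "v ^ k = (measure lborel D / measure lborel K) powr (k / n)"
        unfolding D(3) using k by (subst powr_realpow'[symmetric]) (simp_all add: powr_powr)
      then show ?thesis using Kpos by (simp add: powr_divide)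
    qed
    then have "unit_ball_vol (n - r) * (M * (measure lborel D / unit_ball_vol n) powr (k / n)) = A * v ^ k"
      by (simp add: A_def powr_divide)
    finally show ?thesis .
  qed
  have "S \<noteq> {}"
  proof -
    have "bounded K" using K by (simp add: star_body_def star_shaped_at_0_def compact_imp_bounded)
    then obtain R where R: "0 < R" "\<And>x. x \<in> K \<Longrightarrow> norm x \<le> R" by (auto simp: bounded_pos)
    then have "K \<subseteq> cball 0 R" by auto
    moreover have "cball (0 :: real ^ 'n) R \<in> gen_intersection_bodies k"
      using R k n by (intro cball_gen_intersection_body) auto
    ultimately show ?thesis unfolding S_def by blast
  qed
  moreover have "bdd_below S" by (rule bdd_belowI[of _ 0]) (auto simp: S_def)
  \<comment> \<open>The infimum is a limit of admissible ratios, and the bound is a closed condition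
    on the ratio, so no optimal D is required.\<close>
  ultimately have "Inf S \<in> closure S" by (rule closure_contains_Inf)
  moreover have "closure S \<subseteq> {v. avg_section r UNIV K \<le> A * v ^ k}"
    by (intro closure_minimal closed_Collect_le continuous_intros) (use le in auto)
  ultimately have "avg_section r UNIV K \<le> A * Inf S ^ k" by auto
  then have "avg_section r UNIV K
             \<le> unit_ball_vol (n - r) /
                  (unit_ball_vol (n - k - r) * unit_ball_vol n powr (k / n))
                * outer_volume_ratio_dist K (gen_intersection_bodies k) ^ k
                * measure lborel K powr (k / n)
                * avg_section r E0 (K \<inter> E0)"
    unfolding avg[OF E0(1)] by (simp add: A_def S_def outer_volume_ratio_dist_def M_def mult_ac)
  moreover have "avg_section r E (K \<inter> E) \<le> avg_section r E0 (K \<inter> E0)" if "E \<in> grassmannian UNIV (n - k)" for E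
    unfolding avg[OF E0(1)] avg[OF that] using E0(2)[OF that] by (intro mult_left_mono) auto
  ultimately show ?thesis using E0(1) by blast
qed

end
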